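(* Let $n\ge 6$ and let $\rho:B_n\to GL_r(\mathbb{C})$ be an irreducible representation with $r\ge n$. Write $\rho(\sigma_1)=1+A_1$ and suppose $\operatorname{rank}(A_1)=2$. Then $r=n$ and there is $u\in\mathbb{C}^*$, $u\ne 1$, such that $\rho$ is equivalent to the representation $\tau:B_n\to GL_n(\mathbb{C})$ given by $$\tau(\sigma_i)=\begin{pmatrix} I_{i-1}&&&\\ &0&u&\\ &1&0&\\ &&&I_{n-1-i}\end{pmatrix},\qquad i=1,2,\dots,n-1,$$ where $I_k$ is the $k\times k$ identity matrix and blank entries are zero. Moreover, the representations $\tau$ obtained for different values of $u$ (with $u\in\mathbb{C}^*$, $u\neq 1$) are pairwise non-equivalent.
   Context: $B_n$ is the Artin braid group on $n$ strings, $B_n=\langle \sigma_1,\dots,\sigma_{n-1}\mid \sigma_i\sigma_{i+1}\sigma_i=\sigma_{i+1}\sigma_i\sigma_{i+1}\ (1\le i\le n-2),\ \sigma_i\sigma_j=\sigma_j\sigma_i\ (|i-j|\ge 2)\rangle$. Two representations are equivalent if they are conjugate by an invertible complex matrix. In the displayed matrix the block $\begin{pmatrix}0&u\\1&0\end{pmatrix}$ occupies rows and columns $i,i+1$. *)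

theory Defs
  imports
    "HOL-Algebra.Group"
    "HOL-Combinatorics.Transposition"
    "Jordan_Normal_Form.DL_Rank"
begin

section \<open>Groups given by a presentation\<close>

text \<open>
  A letter \<open>(s, True)\<close> stands for the generator \<open>s\<close>, and \<open>(s, False)\<close> for its formal inverse.
  A relation \<open>l = r\<close> between words is given as the pair \<open>(l, r)\<close>.
\<close>

type_synonym 's gword = "('s \<times> bool) list"

definition gwords :: "'s set \<Rightarrow> 's gword set" where
  "gwords S = lists (S \<times> UNIV)"

inductive pres_cong :: "'s set \<Rightarrow> ('s gword \<times> 's gword) set \<Rightarrow> 's gword \<Rightarrow> 's gword \<Rightarrow> bool"
  for S R where
  refl: "w \<in> gwords S \<Longrightarrow> pres_cong S R w w"
| sym: "pres_cong S R v w \<Longrightarrow> pres_cong S R w v"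
| trans: "pres_cong S R u v \<Longrightarrow> pres_cong S R v w \<Longrightarrow> pres_cong S R u w"
| cancel: "a \<in> gwords S \<Longrightarrow> b \<in> gwords S \<Longrightarrow> s \<in> S \<Longrightarrow>
    pres_cong S R (a @ [(s, e), (s, \<not> e)] @ b) (a @ b)"
| rel: "a \<in> gwords S \<Longrightarrow> b \<in> gwords S \<Longrightarrow> (l, r) \<in> R \<Longrightarrow>
    pres_cong S R (a @ l @ b) (a @ r @ b)"

definition pres_rel :: "'s set \<Rightarrow> ('s gword \<times> 's gword) set \<Rightarrow> ('s gword \<times> 's gword) set" where
  "pres_rel S R = {(v, w). pres_cong S R v w}"

definition presented_group :: "'s set \<Rightarrow> ('s gword \<times> 's gword) set \<Rightarrow> 's gword set monoid" where
  "presented_group S R =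
    \<lparr>carrier = gwords S // pres_rel S R,
     mult = (\<lambda>X Y. \<Union>x\<in>X. \<Union>y\<in>Y. pres_rel S R `` {x @ y}),
     one = pres_rel S R `` {[]}\<rparr>"

definition pres_gen :: "'s set \<Rightarrow> ('s gword \<times> 's gword) set \<Rightarrow> 's \<Rightarrow> 's gword set" where
  "pres_gen S R s = pres_rel S R `` {[(s, True)]}"

definition eval_letter :: "('g, 'm) monoid_scheme \<Rightarrow> ('s \<Rightarrow> 'g) \<Rightarrow> 's \<times> bool \<Rightarrow> 'g" where
  "eval_letter G f = (\<lambda>(s, e). if e then f s else inv\<^bsub>G\<^esub> (f s))"

definition eval_gword :: "('g, 'm) monoid_scheme \<Rightarrow> ('s \<Rightarrow> 'g) \<Rightarrow> 's gword \<Rightarrow> 'g" where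
  "eval_gword G f w = foldr (\<lambda>x g. eval_letter G f x \<otimes>\<^bsub>G\<^esub> g) w \<one>\<^bsub>G\<^esub>"

text \<open>
  The homomorphism out of a presented group induced by a map \<open>f\<close> on the generators. It is
  meaningful only if \<open>f\<close> respects the relations; see \<open>pres_lift_hom\<close> and \<open>pres_lift_gen\<close>.
\<close>

definition pres_lift :: "('g, 'm) monoid_scheme \<Rightarrow> ('s \<Rightarrow> 'g) \<Rightarrow> 's gword set \<Rightarrow> 'g" where
  "pres_lift G f X = the_elem (eval_gword G f ` X)"

lemma gwords_Nil [simp]: "[] \<in> gwords S"
  and gwords_append [simp]: "v @ w \<in> gwords S \<longleftrightarrow> v \<in> gwords S \<and> w \<in> gwords S"
  and gwords_Cons [simp]: "(s, e) # w \<in> gwords S \<longleftrightarrow> s \<in> S \<and> w \<in> gwords S"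
  by (auto simp: gwords_def)

context
  fixes S :: "'s set" and R :: "('s gword \<times> 's gword) set"
  assumes R: "R \<subseteq> gwords S \<times> gwords S"
begin

lemma pres_cong_gwords: "pres_cong S R v w \<Longrightarrow> v \<in> gwords S \<and> w \<in> gwords S"
  by (induction rule: pres_cong.induct) (use R in auto)

lemma pres_cong_ctx:
  "pres_cong S R v w \<Longrightarrow> a \<in> gwords S \<Longrightarrow> b \<in> gwords S \<Longrightarrow> pres_cong S R (a @ v @ b) (a @ w @ b)"
proof (induction rule: pres_cong.induct)
  case (refl w)
  then show ?case by (intro pres_cong.refl) auto
next
  case (sym v w)
  then show ?case by (blast intro: pres_cong.sym)
next
  case (trans u v w)
  then show ?case by (blast intro: pres_cong.trans)
next
  case (cancel c d s e)
  then show ?case using pres_cong.cancel[of "a @ c" S "d @ b" s R e] by simp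
next
  case (rel c d l r)
  then show ?case using pres_cong.rel[of "a @ c" S "d @ b" l r R] by simp
qed

lemma pres_rel_equiv: "equiv (gwords S) (pres_rel S R)"
proof (rule equivI)
  show "pres_rel S R \<subseteq> gwords S \<times> gwords S"
    by (auto simp: pres_rel_def dest: pres_cong_gwords)
  show "refl_on (gwords S) (pres_rel S R)"
    by (auto simp: refl_on_def pres_rel_def intro: pres_cong.refl)
  show "Relation.sym (pres_rel S R)"
    by (auto simp: Relation.sym_def pres_rel_def intro: pres_cong.sym)
  show "Relation.trans (pres_rel S R)"
    by (auto simp: Relation.trans_def pres_rel_def intro: pres_cong.trans)
qed

lemma pres_class_eq:
  "v \<in> gwords S \<Longrightarrow> w \<in> gwords S \<Longrightarrow>
    pres_rel S R `` {v} = pres_rel S R `` {w} \<longleftrightarrow> pres_cong S R v w"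
  using eq_equiv_class_iff[OF pres_rel_equiv] by (simp add: pres_rel_def)

lemma pres_mult:
  assumes "v \<in> gwords S" "w \<in> gwords S"
  shows "pres_rel S R `` {v} \<otimes>\<^bsub>presented_group S R\<^esub> pres_rel S R `` {w} = pres_rel S R `` {v @ w}"
proof -
  have "pres_rel S R `` {x @ y} = pres_rel S R `` {v @ w}"
    if "x \<in> pres_rel S R `` {v}" "y \<in> pres_rel S R `` {w}" for x y
  proof -
    have c: "pres_cong S R v x" "pres_cong S R w y"
      using that by (auto simp: pres_rel_def)
    note g = pres_cong_gwords[OF c(1)] pres_cong_gwords[OF c(2)]
    have "pres_cong S R (v @ w) (x @ w)"
      using pres_cong_ctx[OF c(1), of "[]" w] g by simp
    moreover have "pres_cong S R (x @ w) (x @ y)"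
      using pres_cong_ctx[OF c(2), of x "[]"] g by simp
    ultimately show ?thesis
      using g by (auto simp: pres_class_eq intro: pres_cong.trans pres_cong.sym)
  qed
  then have "(\<Union>x\<in>pres_rel S R `` {v}. \<Union>y\<in>pres_rel S R `` {w}. pres_rel S R `` {x @ y}) =
      (\<Union>x\<in>pres_rel S R `` {v}. \<Union>y\<in>pres_rel S R `` {w}. pres_rel S R `` {v @ w})"
    by (intro SUP_cong) simp_all
  moreover have "pres_rel S R `` {v} \<noteq> {}" "pres_rel S R `` {w} \<noteq> {}"
    using assms by (auto simp: pres_rel_def intro: pres_cong.refl)
  ultimately show ?thesis
    by (simp add: presented_group_def)
qed

lemma pres_carrierE:
  assumes "X \<in> carrier (presented_group S R)"
  obtains w where "w \<in> gwords S" "X = pres_rel S R `` {w}"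
  using assms by (auto simp: presented_group_def elim: quotientE)

lemma pres_class_carrier: "w \<in> gwords S \<Longrightarrow> pres_rel S R `` {w} \<in> carrier (presented_group S R)"
  by (auto simp: presented_group_def intro: quotientI)

lemma pres_one: "\<one>\<^bsub>presented_group S R\<^esub> = pres_rel S R `` {[]}"
  by (simp add: presented_group_def)

lemma pres_gen_carrier: "s \<in> S \<Longrightarrow> pres_gen S R s \<in> carrier (presented_group S R)"
  unfolding pres_gen_def by (rule pres_class_carrier) simp

lemma pres_cong_inverse:
  "w \<in> gwords S \<Longrightarrow> \<exists>w'\<in>gwords S. pres_cong S R (w' @ w) []"
proof (induction w)
  case Nil
  show ?case by (rule bexI[of _ "[]"]) (auto intro: pres_cong.refl)
next
  case (Cons x w)
  obtain s e where x: "x = (s, e)" by force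
  with Cons obtain w' where w': "w' \<in> gwords S" "pres_cong S R (w' @ w) []" by auto
  have "pres_cong S R (w' @ [(s, \<not> e), (s, \<not> \<not> e)] @ w) (w' @ w)"
    using Cons.prems w' by (intro pres_cong.cancel) (auto simp: x)
  with w' have "pres_cong S R ((w' @ [(s, \<not> e)]) @ x # w) []"
    by (auto simp: x intro: pres_cong.trans)
  then show ?case
    using Cons.prems w' by (intro bexI[of _ "w' @ [(s, \<not> e)]"]) (auto simp: x)
qed

lemma pres_group: "group (presented_group S R)"
proof (rule groupI)
  fix X assume "X \<in> carrier (presented_group S R)"
  then obtain w where w: "w \<in> gwords S" "X = pres_rel S R `` {w}" by (rule pres_carrierE)
  obtain w' where "w' \<in> gwords S" "pres_cong S R (w' @ w) []"
    using pres_cong_inverse w by blast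
  then show "\<exists>Y\<in>carrier (presented_group S R). Y \<otimes>\<^bsub>presented_group S R\<^esub> X = \<one>\<^bsub>presented_group S R\<^esub>"
    using w by (intro bexI[of _ "pres_rel S R `` {w'}"])
      (auto simp: pres_mult pres_one pres_class_eq pres_class_carrier)
next
  fix X Y assume "X \<in> carrier (presented_group S R)" "Y \<in> carrier (presented_group S R)"
  then show "X \<otimes>\<^bsub>presented_group S R\<^esub> Y \<in> carrier (presented_group S R)"
    by (elim pres_carrierE) (simp add: pres_mult pres_class_carrier)
next
  show "\<one>\<^bsub>presented_group S R\<^esub> \<in> carrier (presented_group S R)"
    by (simp add: pres_one pres_class_carrier)
next
  fix X Y Z assume "X \<in> carrier (presented_group S R)" "Y \<in> carrier (presented_group S R)"
    "Z \<in> carrier (presented_group S R)"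
  then show "X \<otimes>\<^bsub>presented_group S R\<^esub> Y \<otimes>\<^bsub>presented_group S R\<^esub> Z =
      X \<otimes>\<^bsub>presented_group S R\<^esub> (Y \<otimes>\<^bsub>presented_group S R\<^esub> Z)"
    by (elim pres_carrierE) (simp add: pres_mult)
next
  fix X assume "X \<in> carrier (presented_group S R)"
  then show "\<one>\<^bsub>presented_group S R\<^esub> \<otimes>\<^bsub>presented_group S R\<^esub> X = X"
    by (elim pres_carrierE) (simp add: pres_mult pres_one)
qed

context
  fixes G :: "('g, 'm) monoid_scheme" and f :: "'s \<Rightarrow> 'g"
  assumes G: "group G" and f: "\<And>s. s \<in> S \<Longrightarrow> f s \<in> carrier G"
    and rels: "\<And>l r. (l, r) \<in> R \<Longrightarrow> eval_gword G f l = eval_gword G f r"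
begin

interpretation G: group G by (rule G)

lemma eval_gword_simps [simp]:
  "eval_gword G f [] = \<one>\<^bsub>G\<^esub>"
  "eval_gword G f (x # w) = eval_letter G f x \<otimes>\<^bsub>G\<^esub> eval_gword G f w"
  by (simp_all add: eval_gword_def)

lemma eval_letter_closed: "s \<in> S \<Longrightarrow> eval_letter G f (s, e) \<in> carrier G"
  by (auto simp: eval_letter_def f)

lemma eval_gword_closed: "w \<in> gwords S \<Longrightarrow> eval_gword G f w \<in> carrier G"
  by (induction w) (auto simp: eval_letter_closed)

lemma eval_gword_append:
  "v \<in> gwords S \<Longrightarrow> w \<in> gwords S \<Longrightarrow>
    eval_gword G f (v @ w) = eval_gword G f v \<otimes>\<^bsub>G\<^esub> eval_gword G f w"
  by (induction v) (auto simp: eval_letter_closed eval_gword_closed G.m_assoc)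

lemma eval_letter_cancel: "s \<in> S \<Longrightarrow> eval_letter G f (s, e) \<otimes>\<^bsub>G\<^esub> eval_letter G f (s, \<not> e) = \<one>\<^bsub>G\<^esub>"
  by (auto simp: eval_letter_def f)

lemma eval_gword_cong: "pres_cong S R v w \<Longrightarrow> eval_gword G f v = eval_gword G f w"
proof (induction rule: pres_cong.induct)
  case (cancel a b s e)
  then have "eval_gword G f ([(s, e), (s, \<not> e)] @ b) = eval_gword G f b"
    by (simp add: eval_letter_closed eval_gword_closed G.m_assoc[symmetric] eval_letter_cancel)
  then show ?case
    using cancel by (subst (1 2) eval_gword_append) auto
next
  case (rel a b l r)
  then have "l \<in> gwords S" "r \<in> gwords S" using R by auto
  then show ?case using rel by (simp add: eval_gword_append rels)
qed auto

lemma pres_lift_class: "w \<in> gwords S \<Longrightarrow> pres_lift G f (pres_rel S R `` {w}) = eval_gword G f w"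
proof -
  assume w: "w \<in> gwords S"
  have "eval_gword G f ` (pres_rel S R `` {w}) = {eval_gword G f w}"
    using w by (auto simp: pres_rel_def intro: pres_cong.refl dest: eval_gword_cong
        intro!: image_eqI[of _ _ w])
  then show ?thesis by (simp add: pres_lift_def)
qed

lemma pres_lift_hom: "pres_lift G f \<in> hom (presented_group S R) G"
  by (rule homI; elim pres_carrierE)
    (simp_all add: pres_lift_class pres_mult eval_gword_closed eval_gword_append)

lemma pres_lift_gen: "s \<in> S \<Longrightarrow> pres_lift G f (pres_gen S R s) = f s"
  unfolding pres_gen_def by (subst pres_lift_class) (auto simp: eval_letter_def f)

end

end


section \<open>The braid group\<close>

definition braid_relations :: "nat \<Rightarrow> (nat gword \<times> nat gword) set" where
  "braid_relations n =
    {([(i, True), (i + 1, True), (i, True)], [(i + 1, True), (i, True), (i + 1, True)]) | i.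
       1 \<le> i \<and> i + 2 \<le> n} \<union>
    {([(i, True), (j, True)], [(j, True), (i, True)]) | i j.
       i \<in> {1..<n} \<and> j \<in> {1..<n} \<and> \<bar>int i - int j\<bar> \<ge> 2}"

definition braid_group :: "nat \<Rightarrow> nat gword set monoid" where
  "braid_group n = presented_group {1..<n} (braid_relations n)"

definition braid_gen :: "nat \<Rightarrow> nat \<Rightarrow> nat gword set" where
  "braid_gen n i = pres_gen {1..<n} (braid_relations n) i"

lemma braid_relations_gwords: "braid_relations n \<subseteq> gwords {1..<n} \<times> gwords {1..<n}"
  by (auto simp: braid_relations_def)

lemma braid_group: "group (braid_group n)"
  unfolding braid_group_def by (rule pres_group[OF braid_relations_gwords])

lemma braid_gen_carrier: "i \<in> {1..<n} \<Longrightarrow> braid_gen n i \<in> carrier (braid_group n)"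
  unfolding braid_group_def braid_gen_def by (rule pres_gen_carrier[OF braid_relations_gwords])


section \<open>Complex matrix representations\<close>

definition GL :: "nat \<Rightarrow> complex mat monoid" where
  "GL r = units_of (ring_mat TYPE(complex) r ())"

definition representation :: "('g, 'm) monoid_scheme \<Rightarrow> nat \<Rightarrow> ('g \<Rightarrow> complex mat) \<Rightarrow> bool" where
  "representation G r \<rho> \<longleftrightarrow> \<rho> \<in> hom G (GL r)"

definition irreducible_rep :: "('g, 'm) monoid_scheme \<Rightarrow> nat \<Rightarrow> ('g \<Rightarrow> complex mat) \<Rightarrow> bool" where
  "irreducible_rep G r \<rho> \<longleftrightarrow>
    representation G r \<rho> \<and> r > 0 \<and>
    (\<forall>W. subspace class_ring W (module_vec TYPE(complex) r) \<and>
         (\<forall>g\<in>carrier G. \<forall>w\<in>W. \<rho> g *\<^sub>v w \<in> W) \<longrightarrow>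
         W = {0\<^sub>v r} \<or> W = carrier_vec r)"

definition equivalent_reps ::
    "('g, 'm) monoid_scheme \<Rightarrow> nat \<Rightarrow> ('g \<Rightarrow> complex mat) \<Rightarrow> ('g \<Rightarrow> complex mat) \<Rightarrow> bool" where
  "equivalent_reps G r \<rho> \<tau> \<longleftrightarrow>
    (\<exists>P\<in>carrier (GL r). \<forall>g\<in>carrier G. \<tau> g = P * \<rho> g * inv\<^bsub>GL r\<^esub> P)"

lemma GL_group: "group (GL r)"
proof -
  interpret ring "ring_mat TYPE(complex) r ()" by (rule ring_mat)
  show ?thesis unfolding GL_def by (rule units_group)
qed

lemma GL_simps: "(\<otimes>\<^bsub>GL r\<^esub>) = (*)" "\<one>\<^bsub>GL r\<^esub> = 1\<^sub>m r"
  by (simp_all add: GL_def units_of_def ring_mat_simps)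

lemma GL_carrier:
  "carrier (GL r) = {A \<in> carrier_mat r r. \<exists>B\<in>carrier_mat r r. B * A = 1\<^sub>m r \<and> A * B = 1\<^sub>m r}"
  by (simp add: GL_def units_of_def Units_def ring_mat_simps)


section \<open>The standard representation\<close>

definition std_mat :: "nat \<Rightarrow> complex \<Rightarrow> nat \<Rightarrow> complex mat" where
  "std_mat n u i =
    diag_block_mat [1\<^sub>m (i - 1), mat_of_rows_list 2 [[0, u], [1, 0]], 1\<^sub>m (n - 1 - i)]"

definition std_rep :: "nat \<Rightarrow> complex \<Rightarrow> nat gword set \<Rightarrow> complex mat" where
  "std_rep n u = pres_lift (GL n) (std_mat n u)"

definition monomial_mat :: "nat \<Rightarrow> (nat \<Rightarrow> nat) \<Rightarrow> (nat \<Rightarrow> complex) \<Rightarrow> complex mat" where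
  "monomial_mat n p c = mat n n (\<lambda>(j, k). if j = p k then c k else 0)"

lemma monomial_mat_mult:
  assumes "q \<in> {..<n} \<rightarrow> {..<n}"
  shows "monomial_mat n p c * monomial_mat n q d = monomial_mat n (p \<circ> q) (\<lambda>k. c (q k) * d k)"
proof (rule eq_matI)
  fix j k assume "j < dim_row (monomial_mat n (p \<circ> q) (\<lambda>k. c (q k) * d k))"
    "k < dim_col (monomial_mat n (p \<circ> q) (\<lambda>k. c (q k) * d k))"
  then have jk: "j < n" "k < n" by (auto simp: monomial_mat_def)
  have "(monomial_mat n p c * monomial_mat n q d) $$ (j, k) =
      (\<Sum>l\<in>{0..<n}. (if j = p l then c l else 0) * (if l = q k then d k else 0))"
    using jk by (simp add: monomial_mat_def scalar_prod_def)
  also have "\<dots> = (\<Sum>l\<in>{0..<n}. if l = q k then (if j = p l then c l else 0) * d k else 0)"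
    by (intro sum.cong) auto
  also have "\<dots> = (if j = p (q k) then c (q k) else 0) * d k"
    using funcset_mem[OF assms, of k] jk by simp
  finally show "(monomial_mat n p c * monomial_mat n q d) $$ (j, k) =
      monomial_mat n (p \<circ> q) (\<lambda>k. c (q k) * d k) $$ (j, k)"
    using jk by (simp add: monomial_mat_def)
qed (auto simp: monomial_mat_def)

lemma monomial_mat_cong:
  "(\<And>k. k < n \<Longrightarrow> p k = q k \<and> c k = d k) \<Longrightarrow> monomial_mat n p c = monomial_mat n q d"
  by (auto simp: monomial_mat_def intro!: eq_matI)

lemma one_monomial: "1\<^sub>m n = monomial_mat n id (\<lambda>_. 1)"
  by (auto simp: monomial_mat_def)

lemma std_mat_monomial:
  assumes "i \<in> {1..<n}"
  shows "std_mat n u i = monomial_mat n (transpose (i - 1) i) (\<lambda>k. if k = i then u else 1)"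
proof -
  obtain a where a: "i = Suc a" using assms by (cases i) auto
  define b where "b = n - 1 - i"
  have n: "n = a + 2 + b" using assms by (auto simp: a b_def)
  define B where "B = mat_of_rows_list 2 [[0, u], [1, 0]]"
  have d: "dim_row B = 2" "dim_col B = 2"
    by (simp_all add: B_def mat_of_rows_list_def)
  have B: "B $$ (0, 0) = 0" "B $$ (0, Suc 0) = u" "B $$ (Suc 0, 0) = 1" "B $$ (Suc 0, Suc 0) = 0"
    by (simp_all add: B_def mat_of_rows_list_def)
  have std: "std_mat n u i = diag_block_mat [1\<^sub>m a, B, 1\<^sub>m b]"
    by (simp add: std_mat_def B_def a b_def)
  have dim: "dim_row (std_mat n u i) = n" "dim_col (std_mat n u i) = n"
    unfolding std by (simp_all add: Let_def d n)
  show ?thesis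
  proof (rule eq_matI)
    fix j k assume "j < dim_row (monomial_mat n (transpose (i - 1) i) (\<lambda>k. if k = i then u else 1))"
      "k < dim_col (monomial_mat n (transpose (i - 1) i) (\<lambda>k. if k = i then u else 1))"
    then have jk: "j < a + 2 + b" "k < a + 2 + b" by (simp_all add: monomial_mat_def n)
    have cases: "l < a \<or> l = a \<or> l = Suc a \<or> (\<exists>m. l = a + 2 + m \<and> m < b)" if "l < a + 2 + b" for l
      using that by presburger
    have "std_mat n u i $$ (j, k) = (if j = transpose a (Suc a) k then if k = i then u else 1 else 0)"
      unfolding std
      using cases[OF jk(1)] cases[OF jk(2)]
      by (elim disjE exE conjE) (simp_all add: Let_def d B a transpose_def)
    then show "std_mat n u i $$ (j, k) =
        monomial_mat n (transpose (i - 1) i) (\<lambda>k. if k = i then u else 1) $$ (j, k)"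
      using jk by (simp add: monomial_mat_def n a)
  qed (simp_all add: dim monomial_mat_def)
qed

lemma transposition_funcset: "i \<in> {1..<n} \<Longrightarrow> transpose (i - 1) i \<in> {..<n} \<rightarrow> {..<n}" for i n :: nat
  by (auto simp: transpose_def)

lemma std_mat_carrier:
  assumes "u \<noteq> 0" "i \<in> {1..<n}"
  shows "std_mat n u i \<in> carrier (GL n)"
proof -
  let ?M = "monomial_mat n (transpose (i - 1) i) (\<lambda>k. if k = i then u else 1)"
  let ?N = "monomial_mat n (transpose (i - 1) i) (\<lambda>k. if k = i - 1 then 1 / u else 1)"
  note mult = monomial_mat_mult[OF transposition_funcset[OF assms(2)]]
  have "?M * ?N = 1\<^sub>m n"
    unfolding one_monomial mult
    by (rule monomial_mat_cong) (use assms in \<open>auto simp: transpose_def\<close>)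
  moreover have "?N * ?M = 1\<^sub>m n"
    unfolding one_monomial mult
    by (rule monomial_mat_cong) (use assms in \<open>auto simp: transpose_def\<close>)
  moreover have "?M \<in> carrier_mat n n" "?N \<in> carrier_mat n n"
    by (auto simp: monomial_mat_def)
  ultimately show ?thesis
    unfolding GL_carrier std_mat_monomial[OF assms(2)] by blast
qed

lemma std_mat_braid:
  assumes "1 \<le> i" "i + 2 \<le> n"
  shows "std_mat n u i * (std_mat n u (i + 1) * std_mat n u i) =
    std_mat n u (i + 1) * (std_mat n u i * std_mat n u (i + 1))"
proof -
  obtain a where a: "i = Suc a" using assms by (cases i) auto
  have i: "i \<in> {1..<n}" "i + 1 \<in> {1..<n}" using assms by auto
  let ?s = "transpose (i - 1) i" and ?t = "transpose (i + 1 - 1) (i + 1)"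
  have st: "?s \<in> {..<n} \<rightarrow> {..<n}" "?t \<in> {..<n} \<rightarrow> {..<n}"
    using transposition_funcset[OF i(1)] transposition_funcset[OF i(2)] by auto
  then have st': "?s \<circ> ?t \<in> {..<n} \<rightarrow> {..<n}" "?t \<circ> ?s \<in> {..<n} \<rightarrow> {..<n}"
    by auto
  show ?thesis
    unfolding std_mat_monomial[OF i(1)] std_mat_monomial[OF i(2)]
      monomial_mat_mult[OF st(1)] monomial_mat_mult[OF st(2)]
      monomial_mat_mult[OF st'(1)] monomial_mat_mult[OF st'(2)]
    by (rule monomial_mat_cong) (auto simp: a transpose_def)
qed

lemma std_mat_commute:
  assumes "i \<in> {1..<n}" "j \<in> {1..<n}" "\<bar>int i - int j\<bar> \<ge> 2"
  shows "std_mat n u i * std_mat n u j = std_mat n u j * std_mat n u i"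
proof -
  obtain a b where ab: "i = Suc a" "j = Suc b"
    using assms(1,2) by (cases i; cases j) auto
  have "a \<noteq> b" "a \<noteq> Suc b" "b \<noteq> Suc a"
    using assms(3) by (auto simp: ab)
  then show ?thesis
    unfolding std_mat_monomial[OF assms(1)] std_mat_monomial[OF assms(2)]
      monomial_mat_mult[OF transposition_funcset[OF assms(1)]]
      monomial_mat_mult[OF transposition_funcset[OF assms(2)]]
    by (intro monomial_mat_cong) (auto simp: ab transpose_def)
qed

lemma std_mat_relations:
  assumes "u \<noteq> 0" "(l, r) \<in> braid_relations n"
  shows "eval_gword (GL n) (std_mat n u) l = eval_gword (GL n) (std_mat n u) r"
proof -
  have [simp]: "std_mat n u i * 1\<^sub>m n = std_mat n u i" if "i \<in> {1..<n}" for i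
    using std_mat_carrier[OF assms(1) that] by (auto simp: GL_carrier)
  show ?thesis
    using assms(2) std_mat_braid[of _ n u] std_mat_commute[of _ n _ u]
    by (auto simp: braid_relations_def eval_gword_def eval_letter_def GL_simps)
qed

lemma std_rep_representation: "u \<noteq> 0 \<Longrightarrow> representation (braid_group n) n (std_rep n u)"
  unfolding representation_def braid_group_def std_rep_def
  by (rule pres_lift_hom[OF braid_relations_gwords GL_group std_mat_carrier std_mat_relations])

lemma std_rep_gen: "u \<noteq> 0 \<Longrightarrow> i \<in> {1..<n} \<Longrightarrow> std_rep n u (braid_gen n i) = std_mat n u i"
  unfolding std_rep_def braid_gen_def
  by (rule pres_lift_gen[OF braid_relations_gwords GL_group std_mat_carrier std_mat_relations])

end

theory Submission
  imports Defs "HOL-Library.Function_Algebras"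
begin

text \<open>
  The idea. Write \<open>\<sigma>\<^sub>i = 1 + A\<^sub>i\<close>. The \<open>A\<^sub>i\<close> are conjugate, so their images \<open>U\<^sub>i\<close> are planes,
  and irreducibility gives two facts that are used throughout: the planes span the space \<open>V\<close>, and
  no nonzero vector is killed by all the \<open>A\<^sub>i\<close>. Conjugation inside the braid group acts transitively
  on the pairs \<open>(i, i \<plusminus> 1)\<close>, and on the pairs \<open>i + 2 \<le> j\<close>. Hence either all neighbouring planes
  meet nontrivially or none do, and likewise for all distant planes. This leaves four configurations,
  three of which force \<open>dim V < n\<close>.
  
  \<^item> No two planes meet (\<open>disjoint_images_impossible\<close>). Then distant \<open>A\<^sub>i\<close>, \<open>A\<^sub>j\<close> have product zero,
    and the braid relation splits into \<open>A\<^sub>i + A\<^sub>i\<^sup>2 + A\<^sub>i A\<^sub>j A\<^sub>i = 0\<close> for each neighbour \<open>j\<close> of \<open>i\<close>. An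
    eigenvector of \<open>A\<^sub>1\<close> in \<open>U\<^sub>1\<close>, transported along the chain, spans an invariant subspace with one
    vector for each generator, so of dimension at most \<open>n - 1\<close>. It is a reduced Burau representation.
  \<^item> Only distant planes meet (\<open>far_only_impossible\<close>). Every \<open>U\<^sub>k\<close> with \<open>k \<ge> 4\<close> meets both of the
    independent planes \<open>U\<^sub>1\<close> and \<open>U\<^sub>2\<close>, so it lies in their sum, and \<open>U\<^sub>3\<close> adds at most one dimension:
    \<open>dim V \<le> 5\<close>.
  \<^item> All planes meet (\<open>all_meet_impossible\<close>). Planes that meet pairwise either lie in a common
    3-dimensional space or share a line, and a shared line is invariant because distant \<open>A\<^sub>i\<close> commute.
  \<^item> Only neighbours meet. The lines \<open>U\<^sub>i \<inter> U\<^sub>i\<^sub>+\<^sub>1\<close>, completed by one more line in \<open>U\<^sub>1\<close> and one in the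
    last plane, are spanned by vectors \<open>v\<^sub>0, \<dots>, v\<^sub>n\<^sub>-\<^sub>1\<close> such that \<open>U\<^sub>i\<close> is the span of \<open>v\<^sub>i\<^sub>-\<^sub>1\<close> and \<open>v\<^sub>i\<close>,
    and \<open>A\<^sub>i\<close> kills all the others (\<open>chain_vectors\<close>). So \<open>dim V \<le> n\<close>. On \<open>U\<^sub>i\<close> the operator \<open>A\<^sub>i\<close> is an
    invertible 2 by 2 matrix. Comparing coefficients in the braid relation on three consecutive vectors
    shows that its diagonal entries are \<open>-1\<close> and that the product \<open>u\<close> of its off-diagonal entries does
    not depend on \<open>i\<close> (\<open>braid_coefficients\<close>). After rescaling the \<open>v\<^sub>j\<close> this is the standard
    representation (\<open>normal_form\<close>). Here \<open>u \<noteq> 0\<close> because \<open>\<sigma>\<^sub>i\<close> is invertible, and \<open>u \<noteq> 1\<close> because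
    \<open>A\<^sub>i\<close> has rank 2.
  
  The argument takes place in an arbitrary complex vector space, where the linear algebra of spans and
  independent sets is convenient. Matrices are brought into that setting by letting an \<open>r\<close> by \<open>r\<close> matrix
  act on the first \<open>r\<close> coordinates of functions \<open>nat \<Rightarrow> complex\<close> and fix the others.
  
  Different parameters give non-equivalent representations because the square of \<open>\<tau>(\<sigma>\<^sub>1)\<close> is diagonal
  with eigenvalues \<open>u\<close> and 1.
\<close>

section \<open>Planes and finite-dimensional subspaces\<close>

text \<open>
  The global interpretation of \<open>vector_space\<close> by real vector spaces would overlay definitions made
  in that locale by their real instances, so they are made in an extension of it.
\<close>

locale complex_space = vector_space scale
  for scale :: "complex \<Rightarrow> 'v::ab_group_add \<Rightarrow> 'v" (infixr "*s" 75)
begin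

text \<open>
  Invariance under an invertible operator gives invariance under its inverse: the image of a basis
  of \<open>W\<close> is an independent set of the same size inside \<open>W\<close>.
\<close>

lemma injective_image_eq:
  assumes f: "Vector_Spaces.linear scale scale f" "inj f"
    and E: "finite E" "W \<subseteq> span E" and W: "subspace W" "f ` W \<subseteq> W"
  shows "f ` W = W"
proof -
  interpret f: Vector_Spaces.linear scale scale f by (rule f(1))
  obtain B where B: "B \<subseteq> W" "\<not> dependent B" "W \<subseteq> span B"
    using maximal_independent_subset[of W] by blast
  have fin: "finite B"
    using independent_span_bound[OF E(1) B(2)] B(1) E(2) by blast
  have ind: "\<not> dependent (f ` B)"
    using f.independent_injective_image[OF B(2)] f(2) by (meson inj_on_subset subset_UNIV)
  have card: "card (f ` B) = card B"
    using f(2) by (meson card_image inj_on_subset subset_UNIV)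
  have fB: "f ` B \<subseteq> W" using B(1) W(2) by auto
  have "W \<subseteq> span (f ` B)"
  proof (rule ccontr)
    assume "\<not> W \<subseteq> span (f ` B)"
    then obtain w where w: "w \<in> W" "w \<notin> span (f ` B)" by auto
    then have "w \<notin> f ` B" using span_base by blast
    have "\<not> dependent (insert w (f ` B))" using w(2) ind by (rule independent_insertI)
    then have "card (insert w (f ` B)) \<le> card B"
      using independent_span_bound[OF fin] w(1) fB B(3) by blast
    then show False using \<open>w \<notin> f ` B\<close> card fin by simp
  qed
  also have "span (f ` B) = f ` span B" by (rule f.span_image)
  also have "\<dots> \<subseteq> f ` W" using span_minimal[OF B(1) W(1)] by auto
  finally show ?thesis using W(2) by auto
qed

lemma span_pair_iff: "z \<in> span {x, y} \<longleftrightarrow> (\<exists>a b. z = scale a x + scale b y)"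
proof -
  have "z \<in> span {x, y} \<longleftrightarrow> (\<exists>a b. z - scale a x - scale b y = 0)"
    by (simp add: span_breakdown_eq)
  also have "\<dots> \<longleftrightarrow> (\<exists>a b. z = scale a x + scale b y)"
    by (simp add: algebra_simps)
  finally show ?thesis .
qed

lemma span_single_iff: "z \<in> span {x} \<longleftrightarrow> (\<exists>a. z = scale a x)"
  by (simp add: span_breakdown_eq)

definition indep2 :: "'v \<Rightarrow> 'v \<Rightarrow> bool" where
  "indep2 x y \<longleftrightarrow> x \<noteq> y \<and> \<not> dependent {x, y}"

definition plane :: "'v set \<Rightarrow> bool" where
  "plane U \<longleftrightarrow> (\<exists>x y. indep2 x y \<and> U = span {x, y})"

lemma indep2_commute: "indep2 x y \<Longrightarrow> indep2 y x"
  by (auto simp: indep2_def insert_commute)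

text \<open>
  The usual source of independence below: two nonzero vectors that a subspace tells apart, such as
  vectors of two planes with trivial intersection.
\<close>

lemma indep2I:
  assumes "x \<noteq> 0" "x \<in> W" "subspace W" "y \<notin> W"
  shows "indep2 x y"
proof -
  have "y \<notin> span {x}" using span_minimal[of "{x}" W] assms by auto
  moreover have "\<not> dependent {x}" using assms(1) by (simp add: independent_insert)
  ultimately have "\<not> dependent {y, x}" by (rule independent_insertI)
  then show ?thesis using assms by (auto simp: indep2_def insert_commute)
qed

lemma indep2_zero:
  assumes "indep2 x y" "a *s x + b *s y = 0"
  shows "a = 0 \<and> b = 0"
proof -
  have "x \<notin> span {y}" "y \<notin> span {x}"
    using assms(1) by (auto simp: indep2_def dependent_def insert_Diff_if)
  moreover have "x = (- b / a) *s y" if "a \<noteq> 0"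
  proof -
    have "(1 / a) *s (a *s x) = (1 / a) *s ((- b) *s y)"
      using assms(2) by (metis eq_neg_iff_add_eq_0 scale_minus_left)
    then show ?thesis using that by simp
  qed
  moreover have "y = (- a / b) *s x" if "b \<noteq> 0"
  proof -
    have "(1 / b) *s (b *s y) = (1 / b) *s ((- a) *s x)"
      using assms(2) by (metis eq_neg_iff_add_eq_0 scale_minus_left add.commute)
    then show ?thesis using that by simp
  qed
  ultimately show ?thesis by (metis span_single_iff)
qed

lemma indep2_iff: "indep2 x y \<longleftrightarrow> (\<forall>a b. scale a x + scale b y = 0 \<longrightarrow> a = 0 \<and> b = 0)"
proof
  assume *: "\<forall>a b. scale a x + scale b y = 0 \<longrightarrow> a = 0 \<and> b = 0"
  have "x \<noteq> 0" using *[rule_format, of 1 0] by auto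
  moreover have "y \<notin> span {x}"
    using *[rule_format, of _ "-1"] by (force simp: span_single_iff)
  ultimately show "indep2 x y"
    by (intro indep2I[of _ "span {x}"]) (auto simp: span_base)
qed (use indep2_zero in blast)

lemma plane_subspace: "plane U \<Longrightarrow> subspace U"
  by (auto simp: plane_def)

lemma plane_eq_span:
  assumes U: "plane U" and xy: "indep2 x y" "x \<in> U" "y \<in> U"
  shows "U = span {x, y}"
proof
  obtain p q where pq: "U = span {p, q}" using U by (auto simp: plane_def)
  show "U \<subseteq> span {x, y}"
  proof
    fix z assume z: "z \<in> U"
    show "z \<in> span {x, y}"
    proof (rule ccontr)
      assume nz: "z \<notin> span {x, y}"
      then have "\<not> dependent {z, x, y}"
        using xy(1) independent_insertI by (auto simp: indep2_def)
      then have "card {z, x, y} \<le> card {p, q}"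
        using independent_span_bound[of "{p, q}" "{z, x, y}"] z xy pq by auto
      moreover have "z \<noteq> x" "z \<noteq> y" using nz span_base[of _ "{x, y}"] by auto
      moreover have "card {p, q} \<le> 2" by (simp add: card_insert_if)
      ultimately show False using xy(1) by (simp add: indep2_def)
    qed
  qed
  show "span {x, y} \<subseteq> U" using xy plane_subspace[OF U] by (intro span_minimal) auto
qed

lemma plane_extend:
  assumes "plane U" "x \<in> U" "x \<noteq> 0"
  obtains y where "indep2 x y" "U = span {x, y}"
proof -
  obtain p q where pq: "indep2 p q" "U = span {p, q}" using assms by (auto simp: plane_def)
  have "\<not> (p \<in> span {x} \<and> q \<in> span {x})"
  proof
    assume "p \<in> span {x} \<and> q \<in> span {x}"
    then have "card {p, q} \<le> card {x}"
      using independent_span_bound[of "{x}" "{p, q}"] pq(1) by (auto simp: indep2_def)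
    then show False using pq(1) by (simp add: indep2_def)
  qed
  then obtain y where "y \<in> U" "y \<notin> span {x}" using pq(2) span_base[of _ "{p, q}"] by blast
  moreover from this have "indep2 x y"
    using assms by (intro indep2I[of _ "span {x}"]) (auto simp: span_base)
  ultimately show thesis using that plane_eq_span[OF assms(1)] assms(2) by blast
qed

lemma planes_meet_in_line:
  assumes "plane U" "plane W" "U \<noteq> W" "x \<in> U" "x \<in> W" "x \<noteq> 0"
  shows "U \<inter> W = span {x}"
proof
  show "span {x} \<subseteq> U \<inter> W"
    using assms plane_subspace[of U] plane_subspace[of W] by (auto dest: span_minimal[of "{x}", rotated])
  show "U \<inter> W \<subseteq> span {x}"
  proof
    fix y assume y: "y \<in> U \<inter> W"
    show "y \<in> span {x}"
    proof (rule ccontr)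
      assume "y \<notin> span {x}"
      then have "indep2 x y" using assms(6) by (intro indep2I[of _ "span {x}"]) (auto simp: span_base)
      then have "U = span {x, y}" "W = span {x, y}"
        using plane_eq_span[of _ x y] assms y by auto
      then show False using assms(3) by simp
    qed
  qed
qed

lemma plane_linear_image:
  assumes g: "Vector_Spaces.linear scale scale g" "inj g" and U: "plane U"
  shows "plane (g ` U)"
proof -
  interpret g: Vector_Spaces.linear scale scale g by (rule g(1))
  obtain x y where xy: "indep2 x y" "U = span {x, y}" using U by (auto simp: plane_def)
  have "inj_on g (span {x, y})" by (rule inj_on_subset[OF g(2)]) simp
  then have "\<not> dependent (g ` {x, y})"
    using xy(1) by (intro g.independent_injective_image) (auto simp: indep2_def)
  then have "indep2 (g x) (g y)" using xy(1) g(2) by (auto simp: indep2_def inj_eq)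
  moreover have "g ` U = span {g x, g y}" using g.span_image[of "{x, y}"] xy(2) by simp
  ultimately show ?thesis by (auto simp: plane_def)
qed

text \<open>
  A root \<open>t\<close> of the characteristic polynomial of the 2 by 2 matrix of \<open>f\<close>; this is where the scalars
  have to be complex.
\<close>

lemma eigenvector_in_plane:
  assumes f: "\<And>x y. f (x + y) = f x + f y" "\<And>c x. f (c *s x) = c *s f x"
    and U: "plane U" "f ` U \<subseteq> U"
  obtains w t where "w \<in> U" "w \<noteq> 0" "f w = t *s w"
proof -
  obtain x y where xy: "indep2 x y" "U = span {x, y}" using U by (auto simp: plane_def)
  have nz: "\<alpha> *s x + \<beta> *s y \<noteq> 0" if "\<alpha> \<noteq> 0 \<or> \<beta> \<noteq> 0" for \<alpha> \<beta>
    using indep2_zero[OF xy(1)] that by blast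
  have "x \<in> U" "y \<in> U" using xy(2) by (auto simp: span_base)
  then have "f x \<in> span {x, y}" "f y \<in> span {x, y}" using U(2) xy(2) by auto
  then obtain a b c d where fx: "f x = a *s x + c *s y" and fy: "f y = b *s x + d *s y"
    by (auto simp: span_pair_iff)
  show thesis
  proof (cases "b = 0")
    case True
    then show ?thesis using that[of y d] nz[of 0 1] fy \<open>y \<in> U\<close> by simp
  next
    case False
    have "\<exists>t. t^2 - (a + d) * t + (a * d - b * c) = 0"
    proof
      define r where "r = csqrt ((a + d)^2 - 4 * (a * d - b * c))"
      have "r^2 = (a + d)^2 - 4 * (a * d - b * c)" by (simp add: r_def)
      moreover have "((a + d + r) / 2)^2 - (a + d) * ((a + d + r) / 2) + (a * d - b * c) =
          (r^2 - ((a + d)^2 - 4 * (a * d - b * c))) / 4"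
        by (simp add: field_simps power2_eq_square)
      ultimately show "((a + d + r) / 2)^2 - (a + d) * ((a + d + r) / 2) + (a * d - b * c) = 0"
        by simp
    qed
    then obtain t where t: "t^2 - (a + d) * t + (a * d - b * c) = 0" by blast
    \<comment> \<open>up to sign a column of the adjugate of the matrix of f - t; nonzero because b is\<close>
    let ?w = "b *s x + (t - a) *s y"
    have "f ?w = (b * a + (t - a) * b) *s x + (b * c + (t - a) * d) *s y"
      by (simp add: f fx fy scale_right_distrib scale_left_distrib add.assoc add.left_commute)
    also have "b * a + (t - a) * b = t * b" by (simp add: algebra_simps)
    also have "b * c + (t - a) * d = t * (t - a)" using t by (simp add: algebra_simps power2_eq_square)
    finally have "f ?w = t *s ?w" by (simp add: scale_right_distrib)
    moreover have "?w \<in> U" using xy(2) span_pair_iff by auto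
    ultimately show ?thesis using that nz[of b "t - a"] False by blast
  qed
qed

text \<open>
  The two shapes that the split braid relation takes on an eigenvector \<open>w\<close> of \<open>A\<^sub>i\<close>.
\<close>

lemma solve_for_neighbour: "w + t *s w + z = 0 \<Longrightarrow> z = (- (1 + t)) *s w"
  by (simp only: scale_minus_left scale_left_distrib scale_one minus_unique)

lemma solve_for_eigenvector:
  assumes "w + z + (- (1 + t)) *s w = 0" shows "z = t *s w"
proof -
  have "w + z + (- (1 + t)) *s w = z - t *s w"
    by (simp only: scale_minus_left scale_left_distrib scale_one) simp
  then have "z - t *s w = 0" using assms by (rule subst)
  then show ?thesis by simp
qed

end

section \<open>Linear braid actions\<close>

text \<open>
  A representation of the braid group on the span of \<open>E\<close>, given by the action of the generators on
  a possibly larger space, where they also fix a common complement of that span. This allows the space to be a type while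
  the dimension of the representation remains a variable. Invariance in \<open>irreducible\<close> is stated as
  \<open>S i ` W = W\<close>, which amounts to invariance under the whole group.
\<close>

locale rank_two_braid = complex_space scale
  for scale :: "complex \<Rightarrow> 'v::ab_group_add \<Rightarrow> 'v" (infixr "*s" 75) +
  fixes n :: nat and E :: "'v set" and S :: "nat \<Rightarrow> 'v \<Rightarrow> 'v"
  assumes six: "6 \<le> n"
    and E: "\<not> dependent E" "finite E" "n \<le> card E"
    and linear_gen: "i \<in> {1..<n} \<Longrightarrow> Vector_Spaces.linear scale scale (S i)"
    and bij_gen: "i \<in> {1..<n} \<Longrightarrow> bij (S i)"
    and S_commute: "i \<in> {1..<n} \<Longrightarrow> j \<in> {1..<n} \<Longrightarrow> i + 2 \<le> j \<Longrightarrow> S i (S j x) = S j (S i x)"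
    and S_braid: "1 \<le> i \<Longrightarrow> i + 1 < n \<Longrightarrow> S i (S (i + 1) (S i x)) = S (i + 1) (S i (S (i + 1) x))"
    and S_moves_into_E: "i \<in> {1..<n} \<Longrightarrow> S i x - x \<in> span E"
    and S_fixes_complement: "\<exists>y\<in>span E. \<forall>i\<in>{1..<n}. S i (x - y) = x - y"
    and plane_1: "plane (range (\<lambda>x. S 1 x - x))"
    and irreducible: "subspace W \<Longrightarrow> W \<subseteq> span E \<Longrightarrow> (\<And>i. i \<in> {1..<n} \<Longrightarrow> S i ` W = W) \<Longrightarrow>
      W = {0} \<or> W = span E"
begin

text \<open>
  A constant for the index set prevents the simplifier from rewriting \<open>i \<in> {1..<n}\<close> in conditions of
  rewrite rules.
\<close>

definition "I = {1..<n}"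

lemma mem_I: "i \<in> I \<longleftrightarrow> 1 \<le> i \<and> i < n"
  by (auto simp: I_def)

lemmas linear_S = linear_gen[folded I_def]
  and bij_S = bij_gen[folded I_def]

definition A :: "nat \<Rightarrow> 'v \<Rightarrow> 'v" where "A i x = S i x - x"
definition U :: "nat \<Rightarrow> 'v set" where "U i = range (A i)"
definition far :: "nat \<Rightarrow> nat \<Rightarrow> bool" where
  "far i j \<longleftrightarrow> i \<in> I \<and> j \<in> I \<and> (i + 2 \<le> j \<or> j + 2 \<le> i)"
definition near :: "nat \<Rightarrow> nat \<Rightarrow> bool" where
  "near i j \<longleftrightarrow> i \<in> I \<and> j \<in> I \<and> (j = i + 1 \<or> i = j + 1)"

lemma S_add: "i \<in> I \<Longrightarrow> S i (x + y) = S i x + S i y"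
  and S_diff: "i \<in> I \<Longrightarrow> S i (x - y) = S i x - S i y"
  and S_scale: "i \<in> I \<Longrightarrow> S i (c *s x) = c *s S i x"
  and S_0: "i \<in> I \<Longrightarrow> S i 0 = 0"
proof -
  assume "i \<in> I"
  then interpret Vector_Spaces.linear scale scale "S i" by (rule linear_S)
  show "S i (x + y) = S i x + S i y" "S i (x - y) = S i x - S i y" "S i (c *s x) = c *s S i x" "S i 0 = 0"
    by (simp_all add: add diff scale)
qed

lemma A_add: "i \<in> I \<Longrightarrow> A i (x + y) = A i x + A i y"
  and A_scale: "i \<in> I \<Longrightarrow> A i (c *s x) = c *s A i x"
  and A_0: "i \<in> I \<Longrightarrow> A i 0 = 0"
  by (auto simp: A_def S_add S_diff S_scale S_0 scale_right_diff_distrib)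

lemma S_eq: "S i x = x + A i x"
  by (simp add: A_def)

lemma A_in_U [simp]: "A i x \<in> U i"
  by (simp add: U_def)

lemma S_far: "far i j \<Longrightarrow> S i (S j x) = S j (S i x)"
  using S_commute by (auto simp: far_def I_def)

lemma A_far:
  assumes "far i j"
  shows "A i (A j x) = A j (A i x)"
proof -
  have "i \<in> I" "j \<in> I" using assms by (auto simp: far_def)
  then show ?thesis using S_far[OF assms, of x] by (simp add: A_def S_diff)
qed

lemma S_near: "near i j \<Longrightarrow> S i (S j (S i x)) = S j (S i (S j x))"
  using S_braid[of i x] S_braid[of j x] by (auto simp: near_def I_def)

text \<open>
  The braid relation with the terms common to both sides cancelled.
\<close>

lemma A_near:
  assumes "near i j"
  shows "A i x + A i (A i x) + A i (A j (A i x)) = A j x + A j (A j x) + A j (A i (A j x))"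
proof -
  have ij: "i \<in> I" "j \<in> I" using assms by (auto simp: near_def)
  have expand: "S k (S l (S k x)) = (x + A k x + A l x + A k (A l x) + A l (A k x)) +
      (A k x + A k (A k x) + A k (A l (A k x)))" if "k \<in> I" "l \<in> I" for k l
    by (simp only: S_eq A_add[OF that(1)] A_add[OF that(2)] add.assoc add.commute add.left_commute)
  have "x + A j x + A i x + A j (A i x) + A i (A j x) = x + A i x + A j x + A i (A j x) + A j (A i x)"
    by (simp only: add.assoc add.commute add.left_commute)
  then show ?thesis
    using S_near[OF assms, of x] by (simp only: expand[OF ij] expand[OF ij(2,1)] add_left_cancel)
qed

lemma U_subspace:
  assumes "i \<in> I"
  shows "subspace (U i)"
proof (rule subspaceI)
  show "0 \<in> U i" unfolding U_def by (rule range_eqI[of _ _ 0]) (simp add: A_0 assms)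
  fix x y c assume "x \<in> U i" "y \<in> U i"
  then obtain a b where "x = A i a" "y = A i b" by (auto simp: U_def)
  then show "x + y \<in> U i" "c *s x \<in> U i"
    using A_in_U[of i "a + b"] A_in_U[of i "c *s a"] assms by (auto simp: A_add A_scale)
qed

lemma U_sub: "i \<in> I \<Longrightarrow> U i \<subseteq> span E"
  using S_moves_into_E by (auto simp: U_def A_def I_def)

text \<open>
  All contradictions with \<open>dim V \<ge> n\<close> below go through this bound or its two consequences
  \<open>invariant_span_card\<close> and \<open>U_span_card\<close>.
\<close>

lemma E_span_card:
  assumes "finite B" "span E \<subseteq> span B"
  shows "n \<le> card B"
  using independent_span_bound[OF assms(1) E(1)] assms(2) E span_superset by (metis order_trans)

text \<open>
  For subspaces, invariance under \<open>A\<^sub>i\<close> and under \<open>S\<^sub>i = 1 + A\<^sub>i\<close> is the same, and finite dimension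
  takes care of the inverses.
\<close>

lemma A_invariant_imp:
  assumes W: "subspace W" "W \<subseteq> span E" and inv: "\<And>i x. i \<in> I \<Longrightarrow> x \<in> W \<Longrightarrow> A i x \<in> W"
  shows "W = {0} \<or> span E \<subseteq> W"
proof -
  have "S i ` W = W" if i: "i \<in> I" for i
  proof (rule injective_image_eq[OF linear_S[OF i] _ E(2) W(2) W(1)])
    show "inj (S i)" using bij_S[OF i] by (rule bij_is_inj)
    show "S i ` W \<subseteq> W" using inv[OF i] W(1) by (auto simp: S_eq intro: subspace_add)
  qed
  then show ?thesis using irreducible[OF W] by (auto simp: I_def)
qed

lemma invariant_span_card:
  assumes B: "finite B" "B \<subseteq> span E" and inv: "\<And>i x. i \<in> I \<Longrightarrow> x \<in> B \<Longrightarrow> A i x \<in> span B"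
    and nz: "x \<in> B" "x \<noteq> 0"
  shows "n \<le> card B"
proof -
  have "span B = {0} \<or> span E \<subseteq> span B"
  proof (rule A_invariant_imp)
    show "span B \<subseteq> span E" using B(2) by (intro span_minimal) auto
    fix i y assume i: "i \<in> I" and "y \<in> span B"
    from this(2) show "A i y \<in> span B"
    proof (induction rule: span_induct_alt)
      case base
      then show ?case by (simp add: A_0 i span_zero)
    next
      case (step c x y)
      then show ?case by (simp add: A_add A_scale i inv span_add span_scale)
    qed
  qed auto
  then show ?thesis using E_span_card[OF B(1)] nz span_base[of x B] by auto
qed

lemma killed_is_0:
  assumes "x \<in> span E" "\<And>i. i \<in> I \<Longrightarrow> A i x = 0"
  shows "x = 0"
proof (rule ccontr)
  assume "x \<noteq> 0"
  then have "n \<le> card {x}"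
    by (intro invariant_span_card[of "{x}" x]) (use assms in \<open>auto simp: span_zero\<close>)
  then show False using six by simp
qed

text \<open>
  The span of the images is invariant, and it is not zero since otherwise all \<open>A\<^sub>i\<close> would vanish.
\<close>

lemma E_sub_of_U:
  assumes W: "subspace W" "\<And>i. i \<in> I \<Longrightarrow> U i \<subseteq> W"
  shows "span E \<subseteq> W"
proof -
  let ?W = "span (\<Union>i\<in>I. U i)"
  have sub: "?W \<subseteq> W" using W by (intro span_minimal) auto
  have "?W = {0} \<or> span E \<subseteq> ?W"
  proof (rule A_invariant_imp)
    show "?W \<subseteq> span E" using U_sub by (intro span_minimal) auto
  next
    fix i x assume "i \<in> I"
    then show "A i x \<in> ?W" by (blast intro: span_base A_in_U)
  qed simp
  moreover have "?W \<noteq> {0}"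
  proof
    assume "?W = {0}"
    then have "A i x = 0" if "i \<in> I" for i x using that span_base[of "A i x" "\<Union>i\<in>I. U i"] A_in_U[of i x] by blast
    then have "x = 0" if "x \<in> span E" for x using killed_is_0 that by blast
    then have "span E \<subseteq> span {}" by auto
    then show False using E_span_card[of "{}"] six by simp
  qed
  ultimately show ?thesis using sub by blast
qed

lemma U_span_card:
  assumes "finite B" "\<And>i. i \<in> I \<Longrightarrow> U i \<subseteq> span B"
  shows "n \<le> card B"
  using E_span_card[OF assms(1) E_sub_of_U] assms(2) by auto

lemma U_eq_image: "i \<in> I \<Longrightarrow> U i = A i ` span E"
proof -
  assume i: "i \<in> I"
  have "A i x \<in> A i ` span E" for x
  proof -
    obtain y where "y \<in> span E" "S i (x - y) = x - y" using S_fixes_complement[of x] i by (auto simp: I_def)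
    then show ?thesis using i by (intro image_eqI[of _ _ y]) (auto simp: A_def S_diff algebra_simps)
  qed
  then show ?thesis by (auto simp: U_def)
qed

section \<open>Conjugate pairs\<close>

text \<open>
  Simultaneous conjugacy of two pairs of operators. Any property of the pair \<open>(A\<^sub>i, A\<^sub>j)\<close> that can be
  expressed in terms of images, kernels and intersections is transported along it. The conjugating maps
  that occur are words in the generators, but only their linearity and bijectivity matter.
\<close>

definition conj_pair :: "nat \<times> nat \<Rightarrow> nat \<times> nat \<Rightarrow> bool" where
  "conj_pair = (\<lambda>(i, j) (k, l). \<exists>g. Vector_Spaces.linear scale scale g \<and> bij g \<and>
     (\<forall>x. g (A i x) = A k (g x)) \<and> (\<forall>x. g (A j x) = A l (g x)))"

lemma conj_pair_trans:
  assumes "conj_pair p q" "conj_pair q s"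
  shows "conj_pair p s"
proof -
  obtain i j k l a b where [simp]: "p = (i, j)" "q = (k, l)" "s = (a, b)"
    by (cases p, cases q, cases s)
  obtain g where g: "Vector_Spaces.linear scale scale g" "bij g" "\<And>x. g (A i x) = A k (g x)"
    "\<And>x. g (A j x) = A l (g x)" using assms(1) by (auto simp: conj_pair_def)
  obtain h where h: "Vector_Spaces.linear scale scale h" "bij h" "\<And>x. h (A k x) = A a (h x)"
    "\<And>x. h (A l x) = A b (h x)" using assms(2) by (auto simp: conj_pair_def)
  have "Vector_Spaces.linear scale scale (h \<circ> g)" by (rule Vector_Spaces.linear_compose[OF g(1) h(1)])
  moreover have "bij (h \<circ> g)" using g h by (simp add: bij_comp)
  ultimately show ?thesis using g(3,4) h(3,4) unfolding conj_pair_def by (auto intro!: exI[of _ "h \<circ> g"])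
qed

lemma conj_pair_sym:
  assumes "conj_pair p q" shows "conj_pair q p"
proof -
  obtain i j k l where [simp]: "p = (i, j)" "q = (k, l)"
    by (cases p, cases q)
  obtain g where g: "Vector_Spaces.linear scale scale g" "bij g" "\<And>x. g (A i x) = A k (g x)"
    "\<And>x. g (A j x) = A l (g x)" using assms(1) by (auto simp: conj_pair_def)
  interpret g: Vector_Spaces.linear scale scale g by (rule g(1))
  define h where "h = inv_into UNIV g"
  have hg: "h (g x) = x" "g (h x) = x" for x
    using g(2) by (simp_all add: h_def bij_is_inj bij_is_surj surj_f_inv_f)
  have "Vector_Spaces.linear scale scale h"
    by unfold_locales (metis hg g.add, metis hg g.scale)
  moreover have "bij h" using g(2) by (simp add: h_def bij_imp_bij_inv)
  moreover have "h (A k x) = A i (h x)" "h (A l x) = A j (h x)" for x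
    using g(3,4)[of "h x"] by (metis hg)+
  ultimately show ?thesis unfolding conj_pair_def by auto
qed

lemma conj_pair_swap: "conj_pair (i, j) (k, l) \<Longrightarrow> conj_pair (j, i) (l, k)"
  by (auto simp: conj_pair_def)

lemma conj_pair_commute:
  "conj_pair (i, j) (k, l) \<Longrightarrow> conj_pair (i, j) (k', l') \<Longrightarrow> conj_pair (k, l) (k', l')"
  by (blast intro: conj_pair_trans conj_pair_sym)

lemma conj_pairI:
  assumes g: "Vector_Spaces.linear scale scale g" "bij g"
    "\<And>x. g (S i x) = S k (g x)" "\<And>x. g (S j x) = S l (g x)"
  shows "conj_pair (i, j) (k, l)"
proof -
  interpret g: Vector_Spaces.linear scale scale g by (rule g(1))
  show ?thesis unfolding conj_pair_def using g by (auto intro!: exI[of _ g] simp: A_def g.diff)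
qed

lemma conj_pair_refl: "conj_pair p p"
  unfolding conj_pair_def by (cases p) (auto intro!: exI[of _ "\<lambda>x. x"] linear_ident bij_id[unfolded id_def])

text \<open>
  The word \<open>\<sigma>\<^sub>j \<sigma>\<^sub>j\<^sub>+\<^sub>1\<close> conjugates \<open>\<sigma>\<^sub>j\<close> to \<open>\<sigma>\<^sub>j\<^sub>+\<^sub>1\<close> and commutes with \<open>\<sigma>\<^sub>i\<close>.
\<close>

lemma far_step:
  assumes "far i j" "far i (j + 1)"
  shows "conj_pair (i, j) (i, j + 1)"
proof -
  have j: "j \<in> I" "j + 1 \<in> I" using assms by (auto simp: far_def)
  let ?g = "\<lambda>x. S j (S (j + 1) x)"
  show ?thesis
  proof (rule conj_pairI)
    show "Vector_Spaces.linear scale scale ?g"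
      using Vector_Spaces.linear_compose[OF linear_S[OF j(2)] linear_S[OF j(1)]] by (simp add: o_def)
    show "bij ?g" using bij_comp[OF bij_S[OF j(2)] bij_S[OF j(1)]] by (simp add: o_def)
    show "?g (S i x) = S i (?g x)" for x
      using S_far[OF assms(1)] S_far[OF assms(2)] by simp
    show "?g (S j x) = S (j + 1) (?g x)" for x using S_braid[of j x] j by (simp add: mem_I)
  qed
qed

text \<open>
  Conjugation by \<open>\<sigma>\<^sub>i \<sigma>\<^sub>i\<^sub>+\<^sub>1 \<sigma>\<^sub>i\<^sub>+\<^sub>2\<close> shifts both indices.
\<close>

lemma near_step:
  assumes "1 \<le> i" "i + 2 < n"
  shows "conj_pair (i, i + 1) (i + 1, i + 2)"
proof -
  have j: "i \<in> I" "i + 1 \<in> I" "i + 2 \<in> I" using assms by (auto simp: mem_I)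
  have far: "far i (i + 2)" using j by (auto simp: far_def)
  let ?g = "\<lambda>x. S i (S (i + 1) (S (i + 2) x))"
  show ?thesis
  proof (rule conj_pairI)
    show "Vector_Spaces.linear scale scale ?g"
      using Vector_Spaces.linear_compose[OF linear_S[OF j(3)]
        Vector_Spaces.linear_compose[OF linear_S[OF j(2)] linear_S[OF j(1)]]] by (simp add: o_def)
    show "bij ?g" using bij_comp[OF bij_S[OF j(3)] bij_comp[OF bij_S[OF j(2)] bij_S[OF j(1)]]]
      by (simp add: o_def)
    show "?g (S i x) = S (i + 1) (?g x)" for x
      using S_braid[of i "S (i + 2) x"] S_far[OF far, of x, symmetric] j by (simp add: mem_I)
    show "?g (S (i + 1) x) = S (i + 2) (?g x)" for x
      using S_far[OF far] S_braid[of "i + 1" x] j by (simp add: mem_I)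
  qed
qed

text \<open>
  The half twist \<open>\<sigma>\<^sub>i \<sigma>\<^sub>j \<sigma>\<^sub>i\<close> exchanges the two generators.
\<close>

lemma near_swap:
  assumes "near i j"
  shows "conj_pair (i, j) (j, i)"
proof -
  have j: "i \<in> I" "j \<in> I" using assms by (auto simp: near_def)
  let ?g = "\<lambda>x. S i (S j (S i x))"
  show ?thesis
  proof (rule conj_pairI)
    show "Vector_Spaces.linear scale scale ?g"
      using Vector_Spaces.linear_compose[OF linear_S[OF j(1)]
        Vector_Spaces.linear_compose[OF linear_S[OF j(2)] linear_S[OF j(1)]]] by (simp add: o_def)
    show "bij ?g" using bij_comp[OF bij_S[OF j(1)] bij_comp[OF bij_S[OF j(2)] bij_S[OF j(1)]]]
      by (simp add: o_def)
    show "?g (S i x) = S j (?g x)" "?g (S j x) = S i (?g x)" for x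
      using S_near[OF assms] by simp_all
  qed
qed

lemma near_conj:
  assumes "near i j" "near k l"
  shows "conj_pair (i, j) (k, l)"
proof -
  have up: "conj_pair (1, 2) (i, i + 1)" if "1 \<le> i" "i + 1 < n" for i
    using that
  proof (induction i rule: nat_induct_at_least)
    case base
    then show ?case using conj_pair_refl by (simp add: numeral_2_eq_2)
  next
    case (Suc i)
    then show ?case using conj_pair_trans[OF Suc.IH] near_step[of i] by simp
  qed
  have "conj_pair (1, 2) (i, j)" if "near i j" for i j
  proof (cases "j = i + 1")
    case True
    then show ?thesis using up that by (auto simp: near_def mem_I)
  next
    case False
    then have "i = j + 1" "near j i" using that by (auto simp: near_def mem_I)
    then show ?thesis using up[of j] near_swap[of j i] conj_pair_trans by (auto simp: near_def mem_I)
  qed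
  then show ?thesis using conj_pair_commute assms by blast
qed

text \<open>
  Distant pairs are joined by moving one index at a time: first \<open>j\<close> up to \<open>n - 1\<close>, then \<open>i\<close> down to 1.
  The order of the two indices is kept, so it has to be prescribed.
\<close>

lemma far_conj:
  assumes "far i j" "i < j" "far k l" "k < l"
  shows "conj_pair (i, j) (k, l)"
proof -
  have right: "conj_pair (i, i + 2) (i, j)" if "1 \<le> i" "i + 2 \<le> j" "j < n" for i j
    using that(2,3)
  proof (induction j rule: dec_induct)
    case base
    then show ?case using conj_pair_refl by simp
  next
    case (step j)
    then show ?case using that conj_pair_trans[OF step.IH] far_step[of i j] by (auto simp: far_def mem_I)
  qed
  have left: "conj_pair (1, n - 1) (i, n - 1)" if "1 \<le> i" "i + 3 \<le> n" for i
    using that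
  proof (induction i rule: nat_induct_at_least)
    case base
    then show ?case using conj_pair_refl by simp
  next
    case (Suc i)
    have "conj_pair (i, n - 1) (i + 1, n - 1)"
      by (rule conj_pair_swap, rule far_step) (use Suc.prems Suc.hyps in \<open>auto simp: far_def mem_I\<close>)
    then show ?case using Suc conj_pair_trans[OF Suc.IH] by simp
  qed
  have "conj_pair (1, n - 1) (i, j)" if "far i j" "i < j" for i j
    using conj_pair_trans[OF left] conj_pair_commute[OF right right] that by (auto simp: far_def mem_I)
  then show ?thesis using conj_pair_commute assms by blast
qed

section \<open>How the images meet\<close>

definition meets :: "nat \<Rightarrow> nat \<Rightarrow> bool" where
  "meets i j \<longleftrightarrow> (\<exists>x. x \<noteq> 0 \<and> x \<in> U i \<and> x \<in> U j)"

lemma meets_sym: "meets i j \<Longrightarrow> meets j i"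
  by (auto simp: meets_def)

lemma conj_image:
  assumes "bij g" "\<And>x. g (A i x) = A k (g x)"
  shows "U k = g ` U i"
proof -
  have "range (A k) = A k ` range g" using assms(1) by (simp add: bij_is_surj)
  also have "\<dots> = g ` range (A i)" using assms(2) by (auto simp: image_iff)
  finally show ?thesis by (simp add: U_def)
qed

lemma conj_pair_images:
  assumes "conj_pair (i, j) (k, l)"
  shows "\<exists>g. Vector_Spaces.linear scale scale g \<and> bij g \<and> U k = g ` U i \<and> U l = g ` U j"
proof -
  obtain g where "Vector_Spaces.linear scale scale g" "bij g"
    "\<forall>x. g (A i x) = A k (g x)" "\<forall>x. g (A j x) = A l (g x)"
    using assms unfolding conj_pair_def by auto
  then show ?thesis using conj_image[of g i k] conj_image[of g j l] by blast
qed

lemma conj_meets: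
  assumes "conj_pair (i, j) (k, l)" "meets i j" shows "meets k l"
proof -
  obtain g where lin: "Vector_Spaces.linear scale scale g" and g: "bij g" "U k = g ` U i" "U l = g ` U j"
    using conj_pair_images[OF assms(1)] by blast
  interpret g: Vector_Spaces.linear scale scale g by (rule lin)
  obtain x where x: "x \<noteq> 0" "x \<in> U i" "x \<in> U j" using assms(2) by (auto simp: meets_def)
  have "g x \<noteq> 0" using x(1) g(1) g.zero by (metis bij_is_inj injD)
  moreover have "g x \<in> U k" "g x \<in> U l" using g x by auto
  ultimately show ?thesis by (auto simp: meets_def)
qed

lemma conj_eq: "conj_pair (i, j) (k, l) \<Longrightarrow> U i = U j \<Longrightarrow> U k = U l"
  by (drule conj_pair_images) auto

lemma far_cases: "far i j \<Longrightarrow> i < j \<or> far j i \<and> j < i"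
  by (auto simp: far_def)

lemma near_meets: "near i j \<Longrightarrow> near k l \<Longrightarrow> meets i j \<Longrightarrow> meets k l"
  using near_conj conj_meets by blast

lemma far_meets: "far i j \<Longrightarrow> far k l \<Longrightarrow> meets i j \<Longrightarrow> meets k l"
  using far_conj conj_meets far_cases meets_sym by meson

lemma plane_U:
  assumes "i \<in> I" shows "plane (U i)"
proof -
  have "near 1 2" using six by (simp add: near_def mem_I)
  moreover have "near i (if i = 1 then 2 else i - 1)"
    using assms six by (auto simp: near_def mem_I)
  ultimately obtain j where "conj_pair (1, 2) (i, j)" using near_conj by blast
  then obtain g where "Vector_Spaces.linear scale scale g" "bij g" "U i = g ` U 1"
    using conj_pair_images by blast
  moreover have "plane (U 1)" using plane_1 by (simp add: U_def A_def[abs_def])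
  ultimately show ?thesis using plane_linear_image bij_is_inj by metis
qed

text \<open>
  If all the planes coincided, the representation would have dimension 2.
\<close>

lemma not_all_equal: "\<exists>i\<in>I. U i \<noteq> U 1"
proof (rule ccontr)
  assume "\<not> ?thesis"
  then have eq: "U i = U 1" if "i \<in> I" for i using that by blast
  have "1 \<in> I" using six by (simp add: mem_I)
  then obtain p q where "U 1 = span {p, q}" using plane_U plane_def by blast
  then have "n \<le> card {p, q}" using eq by (intro U_span_card) auto
  also have "\<dots> \<le> 2" by (simp add: card_insert_if)
  finally show False using six by simp
qed

text \<open>
  By conjugacy, one coincidence would propagate along the chain and make all planes equal.
\<close>

lemma near_distinct:
  assumes "near i j" shows "U i \<noteq> U j"
proof
  assume eq: "U i = U j"
  have step: "U k = U (k + 1)" if "1 \<le> k" "k + 1 < n" for k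
    using conj_eq[OF near_conj[OF assms, of k "k + 1"] eq] that by (simp add: near_def mem_I)
  have "k < n \<longrightarrow> U k = U 1" if "1 \<le> k" for k
    using that
  proof (induction k rule: nat_induct_at_least)
    case (Suc k)
    then show ?case using step[of k] by simp
  qed simp
  then show False using not_all_equal by (metis mem_I)
qed

text \<open>
  Again one coincidence propagates: \<open>U\<^sub>k = U\<^sub>1\<close> for \<open>k \<ge> 3\<close>, and \<open>U\<^sub>2 = U\<^sub>4 = U\<^sub>1\<close>.
\<close>

lemma far_distinct:
  assumes "far i j" shows "U i \<noteq> U j"
proof
  assume eq: "U i = U j"
  have all: "U k = U l" if "far k l" "k < l" for k l
    using far_cases[OF assms] far_conj conj_eq eq assms that by metis
  have "U k = U 1" if "k \<in> I" for k
  proof -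
    consider "k = 1" | "k = 2" | "k \<ge> 3" using \<open>k \<in> I\<close> by (force simp: mem_I)
    then show ?thesis
    proof cases
      case 2
      have "far 2 4" "far 1 4" using six by (auto simp: far_def mem_I)
      then show ?thesis using all[of 2 4] all[of 1 4] 2 by simp
    next
      case 3
      then have "far 1 k" using that by (auto simp: far_def mem_I)
      then show ?thesis using all[of 1 k] 3 by simp
    qed simp
  qed
  then show False using not_all_equal by blast
qed

text \<open>
  The product maps into \<open>U\<^sub>i\<close>, and by commutation also into \<open>U\<^sub>j\<close>.
\<close>

lemma A_far_zero:
  assumes "far i j" "\<not> meets i j" shows "A i (A j x) = 0"
  using A_far[OF assms(1), of x] A_in_U[of i "A j x"] A_in_U[of j "A i x"] assms(2)
  by (auto simp: meets_def)

text \<open>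
  One side of the reduced braid relation lies in \<open>U\<^sub>i\<close>, the other one in \<open>U\<^sub>j\<close>, so both vanish.
\<close>

lemma A_near_zero:
  assumes "near i j" "\<not> meets i j" shows "A i x + A i (A i x) + A i (A j (A i x)) = 0"
proof -
  have ij: "i \<in> I" "j \<in> I" using assms by (auto simp: near_def)
  have "A i x + A i (A i x) + A i (A j (A i x)) \<in> U i"
    using U_subspace[OF ij(1)] by (intro subspace_add A_in_U)
  moreover have "A i x + A i (A i x) + A i (A j (A i x)) \<in> U j"
    unfolding A_near[OF assms(1)] using U_subspace[OF ij(2)] by (intro subspace_add A_in_U)
  ultimately show ?thesis using assms(2) by (auto simp: meets_def)
qed

section \<open>Excluded configurations\<close>

text \<open>
  Starting from an eigenvector \<open>w\<close> of \<open>A\<^sub>1\<close> with eigenvalue \<open>t\<close>, each \<open>A\<^sub>i\<close> is applied in turn. The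
  split braid relation shows that the resulting vector in \<open>U\<^sub>i\<close> is again an eigenvector of \<open>A\<^sub>i\<close> with
  eigenvalue \<open>t\<close>, and that the preceding operator maps it to \<open>-(1 + t)\<close> times its predecessor. So
  the \<open>n - 1\<close> vectors span an invariant subspace.
\<close>

lemma disjoint_images_impossible:
  assumes near: "\<And>i j. near i j \<Longrightarrow> \<not> meets i j" and far: "\<And>i j. far i j \<Longrightarrow> \<not> meets i j"
  shows False
proof -
  have 1: "1 \<in> I" using six by (simp add: mem_I)
  obtain w t where w: "w \<in> U 1" "w \<noteq> 0" "A 1 w = t *s w"
    using eigenvector_in_plane[OF A_add[OF 1] A_scale[OF 1] plane_U[OF 1]] A_in_U by blast
  \<comment> \<open>counting from 0: W k is the vector in U (k + 1)\<close>
  define W where "W = rec_nat w (\<lambda>k y. A (k + 2) y)"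
  have W0: "W 0 = w" and WS: "W (Suc k) = A (k + 2) (W k)" for k by (simp_all add: W_def)
  have down: "A (k + 1) (W (Suc k)) = (- (1 + t)) *s W k"
    if k: "k + 2 < n" and IH: "W k \<in> U (k + 1)" "A (k + 1) (W k) = t *s W k" for k
  proof -
    have nr: "near (k + 1) (k + 2)" using k by (auto simp: near_def mem_I)
    obtain y where y: "W k = A (k + 1) y" using IH(1) by (auto simp: U_def)
    have "W k + t *s W k + A (k + 1) (W (Suc k)) = 0"
      using A_near_zero[OF nr near[OF nr], of y] IH(2) by (simp only: y WS)
    then show ?thesis by (rule solve_for_neighbour)
  qed
  have eig: "k + 1 < n \<longrightarrow> W k \<in> U (k + 1) \<and> A (k + 1) (W k) = t *s W k" for k
  proof (induction k)
    case 0
    then show ?case using w by (simp add: W0)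
  next
    case (Suc k)
    show ?case
    proof
      assume k: "Suc k + 1 < n"
      then have IH: "W k \<in> U (k + 1)" "A (k + 1) (W k) = t *s W k" using Suc by auto
      have nr: "near (k + 2) (k + 1)" and kI: "k + 2 \<in> I" using k by (auto simp: near_def mem_I)
      have "W (Suc k) + A (k + 2) (W (Suc k)) + A (k + 2) ((- (1 + t)) *s W k) = 0"
        using A_near_zero[OF nr near[OF nr], of "W k"] down[OF _ IH] k by (simp only: WS)
      then have "W (Suc k) + A (k + 2) (W (Suc k)) + (- (1 + t)) *s W (Suc k) = 0"
        by (simp only: A_scale[OF kI] WS)
      then have "A (k + 2) (W (Suc k)) = t *s W (Suc k)" by (rule solve_for_eigenvector)
      then show "W (Suc k) \<in> U (Suc k + 1) \<and> A (Suc k + 1) (W (Suc k)) = t *s W (Suc k)"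
        by (simp add: WS)
    qed
  qed
  have "n \<le> card (W ` {..<n - 1})"
  proof (rule invariant_span_card)
    show "W ` {..<n - 1} \<subseteq> span E"
    proof (rule image_subsetI)
      fix k assume "k \<in> {..<n - 1}"
      then have "W k \<in> U (k + 1)" "k + 1 \<in> I" using eig[of k] by (auto simp: mem_I)
      then show "W k \<in> span E" using U_sub by blast
    qed
    show "w \<in> W ` {..<n - 1}" using W0 six by (force intro: image_eqI[of _ _ 0])
    fix i x assume i: "i \<in> I" and "x \<in> W ` {..<n - 1}"
    then obtain k where "k < n - 1" and xk: "x = W k" by auto
    then have k: "k + 1 < n" "x = W k" by auto
    have base: "W l \<in> span (W ` {..<n - 1})" if "l + 1 < n" for l using that by (auto intro: span_base)
    obtain y where y: "W k = A (k + 1) y" using eig k by (auto simp: U_def)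
    consider "i = k + 1" | "i = k + 2" | "i + 1 = k + 1" | "far i (k + 1)"
      using i k by (force simp: far_def mem_I)
    then show "A i x \<in> span (W ` {..<n - 1})"
    proof cases
      case 1
      then show ?thesis using eig k base by (auto intro: span_scale)
    next
      case 2
      then show ?thesis using i k base[of "Suc k"] by (auto simp: WS mem_I)
    next
      case 3
      then have "k = Suc (i - 1)" "i - 1 + 1 = i" using i by (auto simp: mem_I)
      then show ?thesis using down[of "i - 1"] eig[of "i - 1"] k base[of "i - 1"] by (auto intro: span_scale)
    next
      case 4
      then show ?thesis using A_far_zero[OF 4 far[OF 4]] by (simp add: k y span_zero)
    qed
  qed (use w in auto)
  also have "\<dots> \<le> n - 1" using card_image_le[of "{..<n - 1}" W] by simp
  finally show False using six by simp
qed

text \<open>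
  For \<open>k \<ge> 4\<close> the plane \<open>U\<^sub>k\<close> is spanned by a vector of \<open>U\<^sub>1\<close> and a vector of \<open>U\<^sub>2\<close>, and one of the two
  generators of \<open>U\<^sub>3\<close> can be taken in \<open>U\<^sub>1\<close>. So five vectors suffice to span everything.
\<close>

lemma far_only_impossible:
  assumes near: "\<And>i j. near i j \<Longrightarrow> \<not> meets i j" and far: "\<And>i j. far i j \<Longrightarrow> meets i j"
  shows False
proof -
  have I: "1 \<in> I" "2 \<in> I" "3 \<in> I" using six by (auto simp: mem_I)
  obtain x1 y1 where U1: "U 1 = span {x1, y1}" using plane_U[OF I(1)] by (auto simp: plane_def)
  obtain x2 y2 where U2: "U 2 = span {x2, y2}" using plane_U[OF I(2)] by (auto simp: plane_def)
  have "far 1 3" using I by (simp add: far_def)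
  then obtain z where z: "z \<noteq> 0" "z \<in> U 1" "z \<in> U 3" using far meets_def by blast
  obtain z' where z': "U 3 = span {z, z'}" using plane_extend[OF plane_U[OF I(3)] z(3,1)] by blast
  let ?B = "{x1, y1, x2, y2, z'}"
  have sub1: "U 1 \<subseteq> span ?B" and sub2: "U 2 \<subseteq> span ?B"
    unfolding U1 U2 by (intro span_mono; auto)+
  have sub3: "U 3 \<subseteq> span ?B"
    unfolding z' using sub1 z(2) by (intro span_minimal) (auto intro: span_base)
  have "n \<le> card ?B"
  proof (rule U_span_card)
    fix k assume k: "k \<in> I"
    show "U k \<subseteq> span ?B"
    proof (cases "k \<le> 3")
      case True
      then have "k = 1 \<or> k = 2 \<or> k = 3" using k by (auto simp: mem_I)
      then show ?thesis using sub1 sub2 sub3 by blast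
    next
      case False
      then have "far 1 k" "far 2 k" using k I by (auto simp: far_def)
      then obtain p q where pq: "p \<noteq> 0" "p \<in> U 1" "p \<in> U k" "q \<noteq> 0" "q \<in> U 2" "q \<in> U k"
        using far unfolding meets_def by meson
      have "near 1 2" using I by (simp add: near_def)
      then have "q \<notin> U 1" using near pq(4,5) by (auto simp: meets_def)
      then have "indep2 p q" using pq U_subspace[OF I(1)] by (intro indep2I[of _ "U 1"])
      then have "U k = span {p, q}" using plane_U[OF k] pq by (intro plane_eq_span)
      moreover have "{p, q} \<subseteq> span ?B" using pq sub1 sub2 by blast
      ultimately show ?thesis by (simp add: span_minimal del: insert_subset)
    qed
  qed simp
  also have "\<dots> \<le> 5" by (simp add: card_insert_if)
  finally show False using six by simp
qed

text \<open>
  Let \<open>x\<close> span the line \<open>U\<^sub>1 \<inter> U\<^sub>2\<close>. If every plane contains \<open>x\<close>, then \<open>x\<close> spans the intersection of any two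
  distant planes; writing \<open>x = A\<^sub>j y\<close> gives \<open>A\<^sub>i x = A\<^sub>j A\<^sub>i y \<in> U\<^sub>i \<inter> U\<^sub>j\<close>, so the line is invariant. If some
  plane \<open>U\<^sub>k\<close> avoids \<open>x\<close>, it meets \<open>U\<^sub>1\<close> and \<open>U\<^sub>2\<close> in different lines and so lies in the 3-dimensional
  space \<open>U\<^sub>1 + U\<^sub>2\<close>. The same holds for every other plane that avoids \<open>x\<close>, while a plane through \<open>x\<close> is
  spanned by \<open>x\<close> and a vector of \<open>U\<^sub>k\<close>.
\<close>

lemma all_meet_impossible:
  assumes near: "\<And>i j. near i j \<Longrightarrow> meets i j" and far: "\<And>i j. far i j \<Longrightarrow> meets i j"
  shows False
proof -
  have meet: "meets i j" if "i \<in> I" "j \<in> I" "i \<noteq> j" for i j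
  proof -
    have "near i j \<or> far i j" using that by (auto simp: near_def far_def)
    then show ?thesis using near far by blast
  qed
  have I: "1 \<in> I" "2 \<in> I" using six by (auto simp: mem_I)
  have n12: "near 1 2" using I by (simp add: near_def)
  then obtain x where x: "x \<noteq> 0" "x \<in> U 1" "x \<in> U 2" using near meets_def by blast
  have int: "U 1 \<inter> U 2 = span {x}"
    using planes_meet_in_line[OF plane_U plane_U] I near_distinct[OF n12] x by blast
  show False
  proof (cases "\<forall>k\<in>I. x \<in> U k")
    case True
    have "n \<le> card {x}"
    proof (rule invariant_span_card)
      show "{x} \<subseteq> span E" using x(2) U_sub I by blast
      fix i z assume i: "i \<in> I" and z: "z \<in> {x}"
      \<comment> \<open>any index distant from i; six or more strings leave room for it\<close>
      define j where "j = (if i \<le> 3 then i + 2 else i - 2)"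
      have fij: "far i j" using i six by (auto simp: far_def j_def mem_I)
      then have j: "j \<in> I" by (simp add: far_def)
      obtain y where "x = A j y" using True j by (auto simp: U_def)
      then have "A i x \<in> U i \<inter> U j" using A_far[OF fij, of y] A_in_U[of i x] A_in_U[of j "A i y"] by simp
      also have "U i \<inter> U j = span {x}"
        using planes_meet_in_line[OF plane_U plane_U] i j far_distinct[OF fij] x True by blast
      finally show "A i z \<in> span {x}" using z by simp
    qed (use x in auto)
    then show False using six by simp
  next
    case False
    then obtain k where k: "k \<in> I" "x \<notin> U k" by blast
    obtain y1 where y1: "U 1 = span {x, y1}" using plane_extend[OF plane_U[OF I(1)] x(2,1)] by blast
    obtain y2 where y2: "U 2 = span {x, y2}" using plane_extend[OF plane_U[OF I(2)] x(3,1)] by blast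
    let ?B = "{x, y1, y2}"
    have sub1: "U 1 \<subseteq> span ?B" and sub2: "U 2 \<subseteq> span ?B"
      unfolding y1 y2 by (intro span_mono; auto)+
    have off: "U m \<subseteq> span ?B" if m: "m \<in> I" "x \<notin> U m" for m
    proof -
      have "m \<noteq> 1" "m \<noteq> 2" using m x by auto
      then obtain p q where pq: "p \<noteq> 0" "p \<in> U m" "p \<in> U 1" "q \<noteq> 0" "q \<in> U m" "q \<in> U 2"
        using meet[OF m(1)] I unfolding meets_def by meson
      have "p \<notin> U 2"
      proof
        assume "p \<in> U 2"
        then have "p \<in> span {x}" using pq int by blast
        then obtain c where c: "p = c *s x" by (auto simp: span_single_iff)
        then have "c \<noteq> 0" using pq(1) by auto
        then have "x = (1 / c) *s p" by (simp add: c)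
        then have "x \<in> U m" using pq(2) U_subspace[OF m(1)] by (simp add: subspace_scale)
        then show False using m(2) by simp
      qed
      then have "indep2 q p" using pq U_subspace[OF I(2)] by (intro indep2I[of _ "U 2"])
      then have "U m = span {q, p}" using plane_U[OF m(1)] pq by (intro plane_eq_span)
      moreover have "{q, p} \<subseteq> span ?B" using pq sub1 sub2 by blast
      ultimately show ?thesis by (simp add: span_minimal del: insert_subset)
    qed
    have "n \<le> card ?B"
    proof (rule U_span_card)
      fix m assume m: "m \<in> I"
      show "U m \<subseteq> span ?B"
      proof (cases "x \<in> U m")
        case True
        then have "m \<noteq> k" using k by auto
        then obtain p where p: "p \<noteq> 0" "p \<in> U m" "p \<in> U k" using meet[OF m k(1)] meets_def by blast
        have "indep2 p x" using p k U_subspace[OF k(1)] by (intro indep2I[of _ "U k"])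
        then have "U m = span {p, x}" using plane_U[OF m] p True by (intro plane_eq_span)
        moreover have "{p, x} \<subseteq> span ?B" using off[OF k] p span_base[of x ?B] by blast
        ultimately show ?thesis by (simp add: span_minimal del: insert_subset)
      qed (use off m in blast)
    qed simp
    also have "\<dots> \<le> 3" by (simp add: card_insert_if)
    finally show False using six by simp
  qed
qed

text \<open>
  Of the four configurations left by transitivity, only the chain survives.
\<close>

lemma chain_configuration:
  shows "near i j \<Longrightarrow> meets i j" and "far i j \<Longrightarrow> \<not> meets i j"
proof -
  have "near 1 2" "far 1 3" using six by (auto simp: near_def far_def mem_I)
  then have "(\<forall>i j. near i j \<longrightarrow> meets i j) \<or> (\<forall>i j. near i j \<longrightarrow> \<not> meets i j)"
    "(\<forall>i j. far i j \<longrightarrow> meets i j) \<or> (\<forall>i j. far i j \<longrightarrow> \<not> meets i j)"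
    using near_meets far_meets by blast+
  then have *: "(\<forall>i j. near i j \<longrightarrow> meets i j) \<and> (\<forall>i j. far i j \<longrightarrow> \<not> meets i j)"
    using disjoint_images_impossible far_only_impossible all_meet_impossible by blast
  show "near i j \<Longrightarrow> meets i j" "far i j \<Longrightarrow> \<not> meets i j" using * by blast+
qed

section \<open>The chain of lines\<close>

lemma A_far_0: "far i j \<Longrightarrow> x \<in> U j \<Longrightarrow> A i x = 0"
  using A_far_zero chain_configuration(2) by (auto simp: U_def)

text \<open>
  The half twist exchanges \<open>A\<^sub>i\<close> and \<open>A\<^sub>j\<close> and preserves the line \<open>U\<^sub>i \<inter> U\<^sub>j\<close>. So a vector on it that is
  killed by \<open>A\<^sub>i\<close> is also killed by \<open>A\<^sub>j\<close>. The other operators kill it anyway, each being distant from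
  \<open>i\<close> or from \<open>j\<close>.
\<close>

lemma intersection_not_killed:
  assumes ij: "near i j" and x: "x \<noteq> 0" "x \<in> U i" "x \<in> U j"
  shows "A i x \<noteq> 0"
proof
  assume 0: "A i x = 0"
  have I: "i \<in> I" "j \<in> I" using ij by (auto simp: near_def)
  obtain g where g: "Vector_Spaces.linear scale scale g" "bij g"
    "\<forall>x. g (A i x) = A j (g x)" "\<forall>x. g (A j x) = A i (g x)"
    using near_swap[OF ij] by (auto simp: conj_pair_def)
  interpret g: Vector_Spaces.linear scale scale g by (rule g(1))
  have "U j = g ` U i" "U i = g ` U j" using g by (auto intro!: conj_image)
  then have "g x \<in> U i \<inter> U j" using x by blast
  also have "U i \<inter> U j = span {x}"
    using planes_meet_in_line[OF plane_U plane_U] I near_distinct[OF ij] x by blast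
  finally obtain c where c: "g x = c *s x" by (auto simp: span_single_iff)
  have "g x \<noteq> 0" using x(1) g(2) g.zero by (metis bij_is_inj injD)
  then have "c \<noteq> 0" using c by auto
  have "A j (g x) = 0" using 0 g(3) g.zero by metis
  then have "c *s A j x = 0" using c A_scale I by simp
  then have j0: "A j x = 0" using \<open>c \<noteq> 0\<close> by simp
  have "A k x = 0" if "k \<in> I" for k
  proof -
    have "k = i \<or> k = j \<or> far k i \<or> far k j" using ij that by (auto simp: near_def far_def)
    then show ?thesis using 0 j0 x A_far_0 by blast
  qed
  then have "x = 0" using killed_is_0 x(2) U_sub I by blast
  then show False using x(1) by simp
qed

text \<open>
  A vector of \<open>U\<^sub>3 \<inter> U\<^sub>4\<close> lies in \<open>U\<^sub>3\<close> and is killed by \<open>A\<^sub>2\<close>; conjugation moves the pair \<open>(3, 2)\<close> to the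
  two ends of the chain, where no further plane is available to cut out a line.
\<close>

lemma end_vector:
  assumes "near k l"
  shows "\<exists>x. x \<noteq> 0 \<and> x \<in> U k \<and> A l x = 0"
proof -
  have n: "near 3 4" "near 3 2" "far 2 4" using six by (auto simp: near_def far_def mem_I)
  obtain x where x: "x \<noteq> 0" "x \<in> U 3" "x \<in> U 4"
    using chain_configuration(1)[OF n(1)] by (auto simp: meets_def)
  then have 2: "A 2 x = 0" using A_far_0 n by blast
  obtain g where g: "Vector_Spaces.linear scale scale g" "bij g"
    "\<forall>x. g (A 3 x) = A k (g x)" "\<forall>x. g (A 2 x) = A l (g x)"
    using near_conj[OF n(2) assms] by (auto simp: conj_pair_def)
  interpret g: Vector_Spaces.linear scale scale g by (rule g(1))
  have "U k = g ` U 3" using g by (auto intro!: conj_image)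
  then have "g x \<in> U k" using x by blast
  moreover have "g x \<noteq> 0" using x(1) g(2) g.zero by (metis bij_is_inj injD)
  moreover have "A l (g x) = 0" using 2 g(4) g.zero by metis
  ultimately show ?thesis by blast
qed

text \<open>
  For \<open>1 \<le> j \<le> n - 2\<close> the vector \<open>v\<^sub>j\<close> spans \<open>U\<^sub>j \<inter> U\<^sub>j\<^sub>+\<^sub>1\<close>; the two remaining vectors come from
  \<open>end_vector\<close>. An index \<open>i\<close> different from \<open>j\<close> and \<open>j + 1\<close> is distant from one of them, so \<open>A\<^sub>i\<close> kills
  \<open>v\<^sub>j\<close>.
\<close>

lemma chain_vectors:
  obtains v where "\<And>i. i \<in> I \<Longrightarrow> v (i - 1) \<in> U i" "\<And>i. i \<in> I \<Longrightarrow> v i \<in> U i"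
    "\<And>i j. i \<in> I \<Longrightarrow> j < n \<Longrightarrow> j \<noteq> i - 1 \<Longrightarrow> j \<noteq> i \<Longrightarrow> A i (v j) = 0"
    "\<And>i. i \<in> I \<Longrightarrow> i + 1 < n \<Longrightarrow> A i (v i) \<noteq> 0"
    "\<And>i. i \<in> I \<Longrightarrow> 1 < i \<Longrightarrow> A i (v (i - 1)) \<noteq> 0"
    "\<And>j. j < n \<Longrightarrow> v j \<noteq> 0"
proof -
  have "\<exists>x. 1 \<le> j \<and> j + 1 < n \<longrightarrow> x \<noteq> 0 \<and> x \<in> U j \<and> x \<in> U (j + 1)" for j
  proof (cases "1 \<le> j \<and> j + 1 < n")
    case True
    then have "near j (j + 1)" by (simp add: near_def mem_I)
    then show ?thesis using chain_configuration(1) unfolding meets_def by blast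
  qed auto
  then obtain f where "\<forall>j. 1 \<le> j \<and> j + 1 < n \<longrightarrow> f j \<noteq> 0 \<and> f j \<in> U j \<and> f j \<in> U (j + 1)"
    using choice[of "\<lambda>j x. 1 \<le> j \<and> j + 1 < n \<longrightarrow> x \<noteq> 0 \<and> x \<in> U j \<and> x \<in> U (j + 1)"] by blast
  then have f: "f j \<noteq> 0" "f j \<in> U j" "f j \<in> U (j + 1)" if "1 \<le> j" "j + 1 < n" for j
    using that by blast+
  have ends: "near 1 2" "near (n - 1) (n - 2)" using six by (auto simp: near_def mem_I)
  obtain a where a: "a \<noteq> 0" "a \<in> U 1" "A 2 a = 0" using end_vector[OF ends(1)] by blast
  obtain b where b: "b \<noteq> 0" "b \<in> U (n - 1)" "A (n - 2) b = 0" using end_vector[OF ends(2)] by blast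
  define v where "v j = (if j = 0 then a else if j = n - 1 then b else f j)" for j
  have v0: "v 0 = a" and vn: "v (n - 1) = b" using six by (auto simp: v_def)
  have vf: "v j = f j" if "1 \<le> j" "j + 1 < n" for j using that by (auto simp: v_def)
  show thesis
  proof
    fix i assume i: "i \<in> I"
    show "v (i - 1) \<in> U i"
    proof (cases "i = 1")
      case False
      then have "1 \<le> i - 1" "i - 1 + 1 < n" "i - 1 + 1 = i" using i by (auto simp: mem_I)
      then show ?thesis using vf[of "i - 1"] f(3)[of "i - 1"] by metis
    qed (use v0 a(2) in simp)
    show "v i \<in> U i"
    proof (cases "i = n - 1")
      case False
      then have "1 \<le> i" "i + 1 < n" using i by (auto simp: mem_I)
      then show ?thesis using vf[of i] f(2)[of i] by metis
    qed (use vn b(2) in simp)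
    show "A i (v i) \<noteq> 0" if "i + 1 < n"
    proof -
      have "near i (i + 1)" "1 \<le> i" using i that by (auto simp: near_def mem_I)
      then show ?thesis using intersection_not_killed f[of i] vf[of i] that by metis
    qed
    show "A i (v (i - 1)) \<noteq> 0" if "1 < i"
    proof -
      have "near i (i - 1)" "1 \<le> i - 1" "i - 1 + 1 < n" "i - 1 + 1 = i"
        using i that by (auto simp: near_def mem_I)
      then show ?thesis using intersection_not_killed f[of "i - 1"] vf[of "i - 1"] by metis
    qed
    fix j assume j: "j < n" "j \<noteq> i - 1" "j \<noteq> i"
    consider "j = 0" | "j = n - 1" | "1 \<le> j" "j + 1 < n" using j by fastforce
    then show "A i (v j) = 0"
    proof cases
      case 1
      then have "i = 2 \<or> far i 1" using i j six by (auto simp: far_def mem_I)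
      then have "A i a = 0" using a(2,3) A_far_0 by blast
      then show ?thesis using 1 v0 by simp
    next
      case 2
      then have "i = n - 2 \<or> far i (n - 1)" using i j six by (auto simp: far_def mem_I)
      then have "A i b = 0" using b(2,3) A_far_0 by blast
      then show ?thesis using 2 vn by simp
    next
      case 3
      then have "far i j \<or> far i (j + 1)" using i j by (auto simp: far_def mem_I)
      then have "A i (f j) = 0" using f(2,3)[OF 3] A_far_0 by blast
      then show ?thesis using vf[OF 3] by simp
    qed
  next
    fix j assume "j < n"
    then consider "j = 0" | "j = n - 1" | "1 \<le> j" "j + 1 < n" by fastforce
    then show "v j \<noteq> 0"
    proof cases
      case 3
      then show ?thesis using vf[OF 3] f(1)[OF 3] by simp
    qed (use v0 vn a(1) b(1) in auto)
  qed
qed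

section \<open>The braid relation on three consecutive vectors\<close>

text \<open>
  The equations \<open>p\<close>, \<open>q\<close>, \<open>s\<close> are the nontrivial coefficients of the reduced braid relation on three
  vectors. Since \<open>b\<close> and \<open>c\<close> do not both vanish, \<open>1 + a + d + a' d = 0\<close>; inserting this into the first
  equation gives \<open>(a d - b c) (1 + a') = 0\<close>. The other block is symmetric.
\<close>

lemma braid_coefficients_algebra:
  fixes a b c d a' b' c' d' :: complex
  assumes nonsing: "a * d \<noteq> b * c" "a' * d' \<noteq> b' * c'"
    and inj: "c = 0 \<Longrightarrow> a \<noteq> - 1" "c' = 0 \<Longrightarrow> b' = 0 \<Longrightarrow> d' \<noteq> - 1"
    and p: "a + (a * a + b * c) + b * a' * c = 0" "c + (c * a + d * c) + d * a' * c = 0"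
    and q: "b + (a * b + b * d) + b * a' * d = 0"
      "d + (c * b + d * d) + d * a' * d = a' + (a' * a' + b' * c') + a' * d * a'"
      "0 = c' + (c' * a' + d' * c') + c' * d * a'"
    and s: "0 = b' + (a' * b' + b' * d') + a' * d * b'" "0 = d' + (c' * b' + d' * d') + c' * d * b'"
  shows "a = -1" "d = -1" "a' = -1" "d' = -1" "b * c = b' * c'"
proof -
  have minus_one: "x = -1" if "1 + x = 0" for x :: complex
    using that by (simp add: eq_neg_iff_add_eq_0 add.commute)
  have "b \<noteq> 0 \<or> c \<noteq> 0"
  proof (rule ccontr)
    assume "\<not> ?thesis"
    then have 0: "b = 0" "c = 0" by auto
    then have "a * (1 + a) = 0" using p(1) by (simp add: distrib_left)
    moreover have "a \<noteq> 0" using nonsing(1) 0 by auto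
    ultimately show False using minus_one[of a] inj(1)[OF 0(2)] by simp
  qed
  moreover have "c * (1 + a + d + a' * d) = 0" using p(2) by (simp add: algebra_simps)
  moreover have "b * (1 + a + d + a' * d) = 0" using q(1) by (simp add: algebra_simps)
  ultimately have e1: "1 + a + d + a' * d = 0" by auto
  have "b' \<noteq> 0 \<or> c' \<noteq> 0"
  proof (rule ccontr)
    assume "\<not> ?thesis"
    then have 0: "b' = 0" "c' = 0" by auto
    then have "d' * (1 + d') = 0" using s(2) by (simp add: distrib_left)
    moreover have "d' \<noteq> 0" using nonsing(2) 0 by auto
    ultimately show False using minus_one[of d'] inj(2)[OF 0(2,1)] by simp
  qed
  moreover have "c' * (1 + a' + d' + a' * d) = 0" using q(3) by (simp add: algebra_simps)
  moreover have "b' * (1 + a' + d' + a' * d) = 0" using s(1) by (simp add: algebra_simps)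
  ultimately have e2: "1 + a' + d' + a' * d = 0" by auto
  have "(a * d - b * c) * (1 + a') =
      a * (1 + a + d + a' * d) - (a + (a * a + b * c) + b * a' * c)"
    by (simp add: algebra_simps)
  then have "(a * d - b * c) * (1 + a') = 0" by (simp only: e1 p(1) mult_zero_right diff_self)
  then have "1 + a' = 0" using nonsing(1) by auto
  then show a': "a' = -1" by (rule minus_one)
  have "(a' * d' - b' * c') * (1 + d) =
      d' * (1 + a' + d' + a' * d) - (d' + (c' * b' + d' * d') + c' * d * b')"
    by (simp add: algebra_simps)
  then have "(a' * d' - b' * c') * (1 + d) = 0" by (simp only: e2 s(2)[symmetric] mult_zero_right diff_self)
  then have "1 + d = 0" using nonsing(2) by auto
  then show d: "d = -1" by (rule minus_one)
  show "a = -1" using e1 by (intro minus_one) (simp add: a' d add.commute)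
  show "d' = -1" using e2 by (intro minus_one) (simp add: a' d add.commute)
  show "b * c = b' * c'" using q(2) by (simp add: a' d mult.commute)
qed

text \<open>
  Here \<open>p\<close>, \<open>q\<close>, \<open>s\<close> are three consecutive vectors of the chain, and \<open>(a, b; c, d)\<close> and \<open>(a', b'; c', d')\<close>
  are the matrices of the two operators on their images.
\<close>

lemma braid_coefficients:
  assumes near: "near i j"
    and Ap: "A i p = a *s p + c *s q" and Aq: "A i q = b *s p + d *s q" and As: "A i s = 0"
    and Bp: "A j p = 0" and Bq: "A j q = a' *s q + c' *s s" and Bs: "A j s = b' *s q + d' *s s"
    and ind: "\<And>x y z. x *s p + y *s q + z *s s = 0 \<Longrightarrow> x = 0 \<and> y = 0 \<and> z = 0"
    and nonsing: "a * d \<noteq> b * c" "a' * d' \<noteq> b' * c'"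
  shows "a = -1" "d = -1" "a' = -1" "d' = -1" "b * c = b' * c'"
proof -
  have I: "i \<in> I" "j \<in> I" using near by (auto simp: near_def)
  define comb where "comb x y z = x *s p + y *s q + z *s s" for x y z
  have add: "comb x y z + comb x' y' z' = comb (x + x') (y + y') (z + z')" for x y z x' y' z'
    by (simp add: comb_def scale_left_distrib add.assoc add.left_commute)
  have eq: "comb x y z = comb x' y' z' \<longleftrightarrow> x = x' \<and> y = y' \<and> z = z'" for x y z x' y' z'
  proof
    assume "comb x y z = comb x' y' z'"
    then have "(x - x') *s p + (y - y') *s q + (z - z') *s s = 0"
      by (simp add: comb_def scale_left_diff_distrib algebra_simps)
    then show "x = x' \<and> y = y' \<and> z = z'" using ind by fastforce
  qed auto
  have A: "A i (comb x y z) = comb (a * x + b * y) (c * x + d * y) 0" for x y z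
    by (simp add: comb_def A_add A_scale I Ap Aq As scale_left_distrib scale_right_distrib mult.commute add.assoc add.left_commute)
  have B: "A j (comb x y z) = comb 0 (a' * y + b' * z) (c' * y + d' * z)" for x y z
    by (simp add: comb_def A_add A_scale I Bp Bq Bs scale_left_distrib scale_right_distrib mult.commute add.assoc add.left_commute)
  have inj: "x = 0" if "k \<in> I" "A k x = - x" for k x
    using bij_S[OF that(1)] that(2) S_0[OF that(1)] by (metis S_eq add.right_inverse bij_is_inj injD)
  note rel = A_near[OF near, of "comb x y z" for x y z, unfolded A B add eq]
  have p0: "p \<noteq> 0" and s0: "s \<noteq> 0" using ind[of 1 0 0] ind[of 0 0 1] by auto
  have inj1: "a \<noteq> -1" if "c = 0" using inj[OF I(1), of p] that p0 Ap by auto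
  have inj2: "d' \<noteq> -1" if "c' = 0" "b' = 0" using inj[OF I(2), of s] that s0 Bs by auto
  have 1: "a + (a * a + b * c) + b * a' * c = 0" "c + (c * a + d * c) + d * a' * c = 0"
    using rel[of 1 0 0] by (simp_all add: mult.assoc)
  have 2: "b + (a * b + b * d) + b * a' * d = 0"
      "d + (c * b + d * d) + d * a' * d = a' + (a' * a' + b' * c') + a' * d * a'"
      "0 = c' + (c' * a' + d' * c') + c' * d * a'"
    using rel[of 0 1 0] by (simp_all add: mult.assoc)
  have 3: "0 = b' + (a' * b' + b' * d') + a' * d * b'" "0 = d' + (c' * b' + d' * d') + c' * d * b'"
    using rel[of 0 0 1] by (simp_all add: mult.assoc)
  show "a = -1" "d = -1" "a' = -1" "d' = -1" "b * c = b' * c'"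
    using braid_coefficients_algebra[OF nonsing inj1 inj2 1 2 3] by blast+
qed

text \<open>
  The vectors of \<open>chain_vectors\<close>, rescaled so that every \<open>S\<^sub>i\<close> maps \<open>w\<^sub>i\<^sub>-\<^sub>1\<close> exactly to \<open>w\<^sub>i\<close>. They are only
  claimed to span; that they form a basis follows from the dimension.
\<close>

lemma normal_form:
  obtains u w where "u \<noteq> 0" "u \<noteq> 1" "span E \<subseteq> span (w ` {..<n})"
    "\<And>i. i \<in> I \<Longrightarrow> S i (w (i - 1)) = w i" "\<And>i. i \<in> I \<Longrightarrow> S i (w i) = u *s w (i - 1)"
    "\<And>i j. i \<in> I \<Longrightarrow> j < n \<Longrightarrow> j \<noteq> i - 1 \<Longrightarrow> j \<noteq> i \<Longrightarrow> S i (w j) = w j"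
proof -
  obtain v where v: "\<And>i. i \<in> I \<Longrightarrow> v (i - 1) \<in> U i" "\<And>i. i \<in> I \<Longrightarrow> v i \<in> U i"
    and kill: "\<And>i j. i \<in> I \<Longrightarrow> j < n \<Longrightarrow> j \<noteq> i - 1 \<Longrightarrow> j \<noteq> i \<Longrightarrow> A i (v j) = 0"
    and nk: "\<And>i. i \<in> I \<Longrightarrow> i + 1 < n \<Longrightarrow> A i (v i) \<noteq> 0"
      "\<And>i. i \<in> I \<Longrightarrow> 1 < i \<Longrightarrow> A i (v (i - 1)) \<noteq> 0"
    and v0: "\<And>j. j < n \<Longrightarrow> v j \<noteq> 0"
    by (rule chain_vectors) blast
  have ind: "indep2 (v (i - 1)) (v i)" if i: "i \<in> I" for i
  proof -
    have ker: "subspace {x. A k x = 0}" if "k \<in> I" for k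
      using that by (auto simp: subspace_def A_add A_scale A_0)
    show ?thesis
    proof (cases "i = 1")
      case True
      have "2 \<in> I" using six by (simp add: mem_I)
      moreover have "A 2 (v 2) \<noteq> 0" "A 2 (v 1) \<noteq> 0" "A 2 (v 0) = 0"
        using nk(1)[of 2] nk(2)[of 2] kill[of 2 0] six by (simp_all add: mem_I)
      ultimately show ?thesis using indep2I[of "v 0" "{x. A 2 x = 0}" "v 1"] ker v0[of 0] six True by simp
    next
      case False
      have k: "i - 1 \<in> I" using i False by (auto simp: mem_I)
      have "A (i - 1) (v i) = 0" "A (i - 1) (v (i - 1)) \<noteq> 0" "v i \<noteq> 0"
        using kill[OF k, of i] nk(1)[OF k] v0[of i] i False by (auto simp: mem_I)
      then have "indep2 (v i) (v (i - 1))" using ker[OF k] by (intro indep2I[of _ "{x. A (i - 1) x = 0}"]) auto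
      then show ?thesis by (rule indep2_commute)
    qed
  qed
  have U: "U i = span {v (i - 1), v i}" if "i \<in> I" for i
    using plane_eq_span[OF plane_U ind v(1) v(2)] that by blast
  have spanE: "span E \<subseteq> W" if W: "subspace W" "\<And>j. j < n \<Longrightarrow> v j \<in> W" for W
  proof (rule E_sub_of_U[OF W(1)])
    fix i assume i: "i \<in> I"
    then have "v (i - 1) \<in> W" "v i \<in> W" using W(2) by (auto simp: mem_I)
    then show "U i \<subseteq> W" using U[OF i] span_minimal[OF _ W(1), of "{v (i - 1), v i}"] by simp
  qed
  \<comment> \<open>the images span the plane U i, so A i is invertible on U i\<close>
  have image: "indep2 (A i (v (i - 1))) (A i (v i))" if i: "i \<in> I" for i
  proof -
    let ?p = "A i (v (i - 1))" and ?q = "A i (v i)"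
    have "span E \<subseteq> {x. A i x \<in> span {?p, ?q}}"
    proof (rule spanE)
      show "subspace {x. A i x \<in> span {?p, ?q}}"
        using i by (auto simp: subspace_def A_0 A_add A_scale span_zero span_add span_scale)
      fix j assume "j < n"
      then show "v j \<in> {x. A i x \<in> span {?p, ?q}}"
        using kill[OF i, of j] by (cases "j = i - 1 \<or> j = i") (auto simp: span_base span_zero)
    qed
    then have sub: "U i \<subseteq> span {?p, ?q}" using U_eq_image[OF i] by auto
    obtain x y where xy: "indep2 x y" "U i = span {x, y}" using plane_U[OF i] by (auto simp: plane_def)
    show ?thesis
    proof (rule ccontr)
      assume neg: "\<not> indep2 ?p ?q"
      have "\<exists>z. span {?p, ?q} \<subseteq> span {z}"
      proof (cases "?p = 0")
        case True
        then show ?thesis by auto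
      next
        case False
        then have "?q \<in> span {?p}" using neg indep2I[of ?p "span {?p}" ?q] span_base[of ?p "{?p}"] by auto
        then have "{?p, ?q} \<subseteq> span {?p}" using span_base[of ?p "{?p}"] by simp
        then show ?thesis using span_minimal subspace_span by blast
      qed
      then obtain z where "{x, y} \<subseteq> span {z}" using sub xy(2) span_superset by blast
      then have "card {x, y} \<le> card {z}" using independent_span_bound[of "{z}"] xy(1) indep2_def by blast
      then show False using xy(1) by (simp add: indep2_def)
    qed
  qed
  \<comment> \<open>the matrix of A i on U i has columns (a i, c i) and (b i, d i)\<close>
  have "\<exists>a c b d. A i (v (i - 1)) = a *s v (i - 1) + c *s v i \<and> A i (v i) = b *s v (i - 1) + d *s v i"
    if i: "i \<in> I" for i
    using A_in_U[of i] unfolding U[OF i] span_pair_iff by metis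
  then obtain a c b d where
    Al: "\<And>i. i \<in> I \<Longrightarrow> A i (v (i - 1)) = a i *s v (i - 1) + c i *s v i" and
    Ar: "\<And>i. i \<in> I \<Longrightarrow> A i (v i) = b i *s v (i - 1) + d i *s v i" by metis
  have nonsing: "a i * d i \<noteq> b i * c i" if i: "i \<in> I" for i
  proof
    assume det: "a i * d i = b i * c i"
    have z: "x = 0 \<and> y = 0" if "x *s A i (v (i - 1)) + y *s A i (v i) = 0" for x y
      using indep2_zero[OF image[OF i] that] .
    have comb: "x *s A i (v (i - 1)) + y *s A i (v i) =
        (x * a i + y * b i) *s v (i - 1) + (x * c i + y * d i) *s v i" for x y
      unfolding Al[OF i] Ar[OF i]
      by (simp add: scale_right_distrib scale_left_distrib add.assoc add.left_commute)
    have "d i = 0 \<and> - c i = 0"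
      by (rule z) (simp only: comb, use det in \<open>simp add: algebra_simps\<close>)
    moreover have "- b i = 0 \<and> a i = 0"
      by (rule z) (simp only: comb, use det in \<open>simp add: algebra_simps\<close>)
    ultimately show False using z[of 1 0] comb[of 1 0] by simp
  qed
  have ind3: "x = 0 \<and> y = 0 \<and> z = 0"
    if i: "1 \<le> i" "i + 1 < n" and eq: "x *s v (i - 1) + y *s v i + z *s v (i + 1) = 0" for i x y z
  proof -
    have iI: "i \<in> I" using i by (simp add: mem_I)
    have "A i (x *s v (i - 1) + y *s v i + z *s v (i + 1)) = 0" using eq A_0 iI by simp
    then have "x *s A i (v (i - 1)) + y *s A i (v i) = 0"
      using kill[OF iI, of "i + 1"] i by (simp add: A_add A_scale iI)
    then have "x = 0 \<and> y = 0" using indep2_zero[OF image[OF iI]] by blast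
    moreover from this have "z *s v (i + 1) = 0" using eq by simp
    then have "z = 0" using v0 i by simp
    ultimately show ?thesis by blast
  qed
  have coeff: "a i = -1 \<and> d i = -1 \<and> a (i + 1) = -1 \<and> d (i + 1) = -1 \<and> b i * c i = b (i + 1) * c (i + 1)"
    if i: "1 \<le> i" "i + 1 < n" for i
  proof -
    have I: "i \<in> I" "i + 1 \<in> I" using i by (auto simp: mem_I)
    have n: "near i (i + 1)" using I by (simp add: near_def)
    have k: "A i (v (i + 1)) = 0" "A (i + 1) (v (i - 1)) = 0" using kill I i by (auto simp: mem_I)
    note bc = braid_coefficients[OF n Al[OF I(1)] Ar[OF I(1)] k _ _ ind3[OF i] nonsing[OF I(1)] nonsing[OF I(2)]]
    show ?thesis using bc Al[OF I(2)] Ar[OF I(2)] by simp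
  qed
  have ad: "a i = -1" "d i = -1" if i: "i \<in> I" for i
    using coeff[of i] coeff[of "i - 1"] i six by (cases "i + 1 < n"; force simp: mem_I)+
  define u where "u = b 1 * c 1"
  have u: "i < n \<longrightarrow> b i * c i = u" if "1 \<le> i" for i
    using that
  proof (induction i rule: nat_induct_at_least)
    case (Suc i)
    then show ?case using coeff[of i] by simp
  qed (simp add: u_def)
  have Sl: "S i (v (i - 1)) = c i *s v i" and Sr: "S i (v i) = b i *s v (i - 1)" if i: "i \<in> I" for i
    using Al[OF i] Ar[OF i] ad[OF i] by (simp_all add: S_eq)
  have c0: "c i \<noteq> 0" if i: "i \<in> I" for i
  proof
    assume "c i = 0"
    then have "S i (v (i - 1)) = S i 0" using Sl[OF i] S_0[OF i] by simp
    then have "v (i - 1) = 0" using bij_S[OF i] by (simp add: bij_is_inj inj_eq)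
    then show False using v0[of "i - 1"] i by (simp add: mem_I less_imp_diff_less)
  qed
  have b0: "b i \<noteq> 0" if i: "i \<in> I" for i
  proof
    assume "b i = 0"
    then have "S i (v i) = S i 0" using Sr[OF i] S_0[OF i] by simp
    then have "v i = 0" using bij_S[OF i] by (simp add: bij_is_inj inj_eq)
    then show False using v0[of i] i by (auto simp: mem_I)
  qed
  have 1: "1 \<in> I" using six by (simp add: mem_I)
  \<comment> \<open>v j has to be multiplied by all the factors c 1, ..., c j that are picked up on the way from v 0\<close>
  define C where "C j = (\<Prod>k\<in>{1..j}. c k)" for j
  have C0: "C j \<noteq> 0" if "j < n" for j
    using c0 that by (auto simp: C_def mem_I)
  have C_step: "C i = C (i - 1) * c i" if "i \<in> I" for i
    using that by (cases i) (auto simp: C_def mem_I)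
  define w where "w j = C j *s v j" for j
  show thesis
  proof (rule that[of u w])
    show "u \<noteq> 0" using c0[OF 1] b0[OF 1] by (simp add: u_def)
    show "u \<noteq> 1" using nonsing[OF 1] ad[OF 1] by (simp add: u_def)
    show "span E \<subseteq> span (w ` {..<n})"
    proof (rule spanE)
      fix j assume j: "j < n"
      then have "(1 / C j) *s w j \<in> span (w ` {..<n})" by (intro span_scale span_base) auto
      then show "v j \<in> span (w ` {..<n})" using C0[OF j] by (simp add: w_def)
    qed simp
    fix i assume i: "i \<in> I"
    show "S i (w (i - 1)) = w i"
      using Sl[OF i] C_step[OF i] by (simp add: w_def S_scale i)
    have "b i * c i = u" using u[of i] i by (simp add: mem_I)
    then show "S i (w i) = u *s w (i - 1)"
      using Sr[OF i] C_step[OF i] by (simp add: w_def S_scale i mult.assoc mult.commute mult.left_commute)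
    fix j assume "j < n" "j \<noteq> i - 1" "j \<noteq> i"
    then have "A i (v j) = 0" using kill[OF i] by blast
    then show "S i (w j) = w j" by (simp add: w_def S_eq A_scale i)
  qed
qed

end

section \<open>Matrices acting on coordinate functions\<close>

definition smul :: "complex \<Rightarrow> (nat \<Rightarrow> complex) \<Rightarrow> nat \<Rightarrow> complex" where
  "smul c f = (\<lambda>i. c * f i)"

interpretation coords: complex_space smul
  by unfold_locales (auto simp: smul_def fun_eq_iff algebra_simps)

definition unit_fun :: "nat \<Rightarrow> nat \<Rightarrow> complex" where
  "unit_fun k = (\<lambda>i. if i = k then 1 else 0)"

text \<open>
  The direct sum of \<open>M\<close> on the first \<open>r\<close> coordinates and the identity on all others.
\<close>

definition act :: "nat \<Rightarrow> complex mat \<Rightarrow> (nat \<Rightarrow> complex) \<Rightarrow> nat \<Rightarrow> complex" where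
  "act r M f = (\<lambda>i. if i < r then (M *\<^sub>v vec r f) $ i else f i)"

text \<open>
  Extension by zero.
\<close>

definition ext :: "complex vec \<Rightarrow> nat \<Rightarrow> complex" where
  "ext v = (\<lambda>i. if i < dim_vec v then v $ i else 0)"

lemma sum_fun_apply: "(\<Sum>x\<in>X. g x) i = (\<Sum>x\<in>X. g x i :: complex)"
  by (induction X rule: infinite_finite_induct) auto

lemma span_unit_funs: "coords.span (unit_fun ` {..<r}) = {f. \<forall>i\<ge>r. f i = 0}"
proof
  show "coords.span (unit_fun ` {..<r}) \<subseteq> {f. \<forall>i\<ge>r. f i = 0}"
    by (rule coords.span_minimal) (auto simp: unit_fun_def coords.subspace_def smul_def)
  show "{f. \<forall>i\<ge>r. f i = 0} \<subseteq> coords.span (unit_fun ` {..<r})"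
  proof
    fix f :: "nat \<Rightarrow> complex" assume f: "f \<in> {f. \<forall>i\<ge>r. f i = 0}"
    have "f = (\<Sum>k<r. smul (f k) (unit_fun k))"
    proof
      fix i
      have "(\<Sum>k<r. smul (f k) (unit_fun k)) i = (\<Sum>k<r. if i = k then f k else 0)"
        by (simp add: sum_fun_apply smul_def unit_fun_def if_distrib cong: if_cong)
      also have "\<dots> = f i" using f by (simp add: sum.delta')
      finally show "f i = (\<Sum>k<r. smul (f k) (unit_fun k)) i" by simp
    qed
    also have "\<dots> \<in> coords.span (unit_fun ` {..<r})"
      by (intro coords.span_sum coords.span_scale coords.span_base) auto
    finally show "f \<in> coords.span (unit_fun ` {..<r})" .
  qed
qed

lemma inj_unit_fun: "inj unit_fun"
proof (rule injI)
  fix x y assume "unit_fun x = unit_fun y"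
  then have "unit_fun x x = unit_fun y x" by simp
  then show "x = y" by (simp add: unit_fun_def split: if_splits)
qed

lemma independent_unit_funs: "\<not> coords.dependent (unit_fun ` X)"
  unfolding coords.independent_explicit_finite_subsets
proof (intro allI impI ballI)
  fix Y u v assume Y: "Y \<subseteq> unit_fun ` X" "finite Y" "(\<Sum>v\<in>Y. smul (u v) v) = 0" and v: "v \<in> Y"
  obtain k where k: "v = unit_fun k" using Y v by auto
  have "0 = (\<Sum>v\<in>Y. smul (u v) v) k" using Y(3) by simp
  also have "\<dots> = (\<Sum>w\<in>Y. if w = v then u v else 0)"
    unfolding sum_fun_apply
  proof (rule sum.cong)
    fix w assume "w \<in> Y"
    then obtain l where "w = unit_fun l" using Y by auto
    then have "w k = (if w = v then 1 else 0)"
      using inj_unit_fun by (simp add: k inj_eq) (simp add: unit_fun_def)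
    then show "smul (u w) w k = (if w = v then u v else 0)" by (simp add: smul_def)
  qed simp
  also have "\<dots> = u v" using v Y(2) by simp
  finally show "u v = 0" by simp
qed

lemma vec_act: "M \<in> carrier_mat r r \<Longrightarrow> vec r (act r M f) = M *\<^sub>v vec r f"
  by (intro eq_vecI) (auto simp: act_def)

lemma act_mult:
  assumes "M \<in> carrier_mat r r" "N \<in> carrier_mat r r"
  shows "act r (M * N) f = act r M (act r N f)"
  unfolding act_def[of r "M * N"] act_def[of r M] vec_act[OF assms(2)]
  using assms by (auto simp: fun_eq_iff act_def)

lemma act_one: "act r (1\<^sub>m r) f = f"
  by (auto simp: act_def)

lemma linear_act:
  assumes M: "M \<in> carrier_mat r r"
  shows "Vector_Spaces.linear smul smul (act r M)"
proof unfold_locales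
  fix f g :: "nat \<Rightarrow> complex" and c
  have "vec r (f + g) = vec r f + vec r g" by auto
  then have "M *\<^sub>v vec r (f + g) = M *\<^sub>v vec r f + M *\<^sub>v vec r g"
    by (simp add: mult_add_distrib_mat_vec[OF M])
  then show "act r M (f + g) = act r M f + act r M g"
    using M by (auto simp: act_def fun_eq_iff)
  have "vec r (smul c f) = c \<cdot>\<^sub>v vec r f" by (auto simp: smul_def)
  then have "M *\<^sub>v vec r (smul c f) = c \<cdot>\<^sub>v (M *\<^sub>v vec r f)"
    by (simp add: mult_mat_vec[OF M])
  then show "act r M (smul c f) = smul c (act r M f)"
    using M by (auto simp: act_def fun_eq_iff smul_def)
qed

lemma bij_act:
  assumes "M \<in> carrier (GL r)"
  shows "bij (act r M)"
proof -
  obtain N where "M \<in> carrier_mat r r" "N \<in> carrier_mat r r" "N * M = 1\<^sub>m r" "M * N = 1\<^sub>m r"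
    using assms by (auto simp: GL_carrier)
  then have "act r N (act r M f) = f" "act r M (act r N f) = f" for f
    by (simp_all add: act_mult[symmetric] act_one)
  then show ?thesis by (intro bij_betw_byWitness[where f' = "act r N"]) auto
qed

section \<open>The image of a matrix of rank two\<close>

text \<open>
  A maximal independent set of columns has two elements and spans the column space.
\<close>

lemma (in vec_space) rank_two_image:
  assumes A: "A \<in> carrier_mat n n" and rank: "rank A = 2"
  obtains p q where "p \<in> carrier_vec n" "q \<in> carrier_vec n"
    "(\<lambda>v. A *\<^sub>v v) ` carrier_vec n = {a \<cdot>\<^sub>v p + b \<cdot>\<^sub>v q | a b. True}"
    "\<And>a b. a \<cdot>\<^sub>v p + b \<cdot>\<^sub>v q = 0\<^sub>v n \<Longrightarrow> a = 0 \<and> b = 0"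
proof -
  let ?C = "set (cols A)"
  have C: "?C \<subseteq> carrier_vec n" using A cols_dim by blast
  have "lin_indpt {}" by (simp add: lin_dep_def)
  then obtain T where T: "maximal T (\<lambda>T. T \<subseteq> ?C \<and> lin_indpt T)"
    using maximal_exists_superset[of ?C "\<lambda>T. T \<subseteq> ?C \<and> lin_indpt T" "{}"] by auto
  then have TC: "T \<subseteq> ?C" and ind: "lin_indpt T" by (auto simp: maximal_def)
  have "card T = 2" using rank_card_indpt[OF A T] rank by simp
  then obtain p q where pq: "T = {p, q}" "p \<noteq> q" by (auto simp: card_2_iff)
  have p: "p \<in> carrier_vec n" and q: "q \<in> carrier_vec n" using pq TC C by auto
  have Tc: "T \<subseteq> carrier_vec n" using p q pq by auto
  have "?C \<subseteq> span T"
  proof (rule ccontr)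
    assume "\<not> ?C \<subseteq> span T"
    then obtain s where s: "s \<in> ?C" "s \<notin> span T" by blast
    have "s \<notin> T" using s Tc in_own_span by blast
    have "lin_indpt (T \<union> {s})"
      using lin_dep_iff_in_span[of T s] s ind C Tc \<open>s \<notin> T\<close> by auto
    then have "T \<union> {s} = T" using T s(1) TC unfolding maximal_def by blast
    then show False using \<open>s \<notin> T\<close> by blast
  qed
  then have "span ?C \<subseteq> span T" using span_subsetI[OF Tc] by blast
  moreover have "span T \<subseteq> span ?C" using span_is_monotone[OF TC] .
  ultimately have "col_space A = span (set [p, q])" by (simp add: col_space_def pq)
  also have "\<dots> = span_list [p, q]" using span_list_as_span[of "[p, q]"] p q by simp
  also have "\<dots> = {a \<cdot>\<^sub>v p + b \<cdot>\<^sub>v q | a b. True}"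
  proof (intro equalityI subsetI)
    fix x assume "x \<in> span_list [p, q]"
    then obtain c where "x = lincomb_list c [p, q]" by (auto simp: span_list_def)
    then show "x \<in> {a \<cdot>\<^sub>v p + b \<cdot>\<^sub>v q | a b. True}" using p q by auto
  next
    fix x assume "x \<in> {a \<cdot>\<^sub>v p + b \<cdot>\<^sub>v q | a b. True}"
    then obtain a b where "x = a \<cdot>\<^sub>v p + b \<cdot>\<^sub>v q" by auto
    then have "x = lincomb_list (\<lambda>i. if i = 0 then a else b) [p, q]" using p q by simp
    then show "x \<in> span_list [p, q]" unfolding span_list_def by blast
  qed
  finally have "col_space A = {a \<cdot>\<^sub>v p + b \<cdot>\<^sub>v q | a b. True}" .
  moreover have "col_space A = (\<lambda>v. A *\<^sub>v v) ` carrier_vec n"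
    unfolding col_space_eq[OF A] using A by auto
  ultimately have "(\<lambda>v. A *\<^sub>v v) ` carrier_vec n = {a \<cdot>\<^sub>v p + b \<cdot>\<^sub>v q | a b. True}" by simp
  moreover have "a = 0 \<and> b = 0" if eq: "a \<cdot>\<^sub>v p + b \<cdot>\<^sub>v q = 0\<^sub>v n" for a b
  proof -
    let ?f = "\<lambda>x. if x = p then a else b"
    have "lincomb ?f (set [p, q]) = lincomb_list (\<lambda>i. ?f ([p, q] ! i)) [p, q]"
      by (rule lincomb_as_lincomb_list_distinct) (use p q pq in auto)
    also have "\<dots> = 0\<^sub>v n" using eq p q pq by simp
    finally have "lincomb ?f T = 0\<^sub>v n" by (simp add: pq)
    moreover have "finite T" by (simp add: pq)
    ultimately have f0: "?f v = 0" if "v \<in> T" for v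
      using ind that unfolding lin_dep_def by blast
    show ?thesis using f0[of p] f0[of q] pq by simp
  qed
  ultimately show thesis using that p q by blast
qed

lemma ext_lin: "p \<in> carrier_vec r \<Longrightarrow> q \<in> carrier_vec r \<Longrightarrow>
    ext (a \<cdot>\<^sub>v p + b \<cdot>\<^sub>v q) = smul a (ext p) + smul b (ext q)"
  by (auto simp: ext_def smul_def fun_eq_iff)

lemma act_minus_id:
  assumes "B \<in> carrier_mat r r"
  shows "act r (1\<^sub>m r + B) f - f = ext (B *\<^sub>v vec r f)"
proof -
  have "(1\<^sub>m r + B) *\<^sub>v vec r f = vec r f + B *\<^sub>v vec r f"
    using assms by (simp add: add_mult_distrib_mat_vec[of _ r r])
  then show ?thesis using assms by (auto simp: act_def ext_def fun_eq_iff)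
qed

lemma plane_of_rank_two:
  assumes B: "B \<in> carrier_mat r r" and rank: "vec_space.rank r B = 2"
  shows "coords.plane (range (\<lambda>f. act r (1\<^sub>m r + B) f - f))"
proof -
  obtain p q where pq: "p \<in> carrier_vec r" "q \<in> carrier_vec r"
    and im: "(\<lambda>v. B *\<^sub>v v) ` carrier_vec r = {a \<cdot>\<^sub>v p + b \<cdot>\<^sub>v q | a b. True}"
    and ind: "\<And>a b. a \<cdot>\<^sub>v p + b \<cdot>\<^sub>v q = 0\<^sub>v r \<Longrightarrow> a = 0 \<and> b = 0"
    by (rule vec_space.rank_two_image[OF B rank]) blast
  have "range (\<lambda>f. act r (1\<^sub>m r + B) f - f) = ext ` (\<lambda>v. B *\<^sub>v v) ` range (vec r)"
    by (simp add: act_minus_id[OF B] image_image)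
  also have "range (vec r :: _ \<Rightarrow> complex vec) = carrier_vec r"
  proof (intro equalityI subsetI)
    fix v :: "complex vec" assume "v \<in> carrier_vec r"
    then have "v = vec r (\<lambda>i. v $ i)" by auto
    then show "v \<in> range (vec r)" by blast
  qed auto
  also have "ext ` (\<lambda>v. B *\<^sub>v v) ` carrier_vec r = coords.span {ext p, ext q}"
  proof (intro equalityI subsetI)
    fix f assume "f \<in> ext ` (\<lambda>v. B *\<^sub>v v) ` carrier_vec r"
    then show "f \<in> coords.span {ext p, ext q}"
      unfolding im coords.span_pair_iff using ext_lin[OF pq] by blast
  next
    fix f assume "f \<in> coords.span {ext p, ext q}"
    then obtain a b where "f = smul a (ext p) + smul b (ext q)"
      unfolding coords.span_pair_iff by blast
    then have "f = ext (a \<cdot>\<^sub>v p + b \<cdot>\<^sub>v q)" by (simp add: ext_lin[OF pq])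
    then show "f \<in> ext ` (\<lambda>v. B *\<^sub>v v) ` carrier_vec r" unfolding im by blast
  qed
  finally have "range (\<lambda>f. act r (1\<^sub>m r + B) f - f) = coords.span {ext p, ext q}" .
  moreover have "coords.indep2 (ext p) (ext q)"
    unfolding coords.indep2_iff
  proof (intro allI impI)
    fix a b assume "smul a (ext p) + smul b (ext q) = 0"
    then have 0: "ext (a \<cdot>\<^sub>v p + b \<cdot>\<^sub>v q) = 0" using ext_lin[OF pq] by simp
    have "a \<cdot>\<^sub>v p + b \<cdot>\<^sub>v q = 0\<^sub>v r"
    proof (rule eq_vecI)
      fix i assume "i < dim_vec (0\<^sub>v r :: complex vec)"
      then show "(a \<cdot>\<^sub>v p + b \<cdot>\<^sub>v q) $ i = (0\<^sub>v r) $ i"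
        using fun_cong[OF 0, of i] pq by (simp add: ext_def)
    qed (use pq in auto)
    then show "a = 0 \<and> b = 0" by (rule ind)
  qed
  ultimately show ?thesis by (auto simp: coords.plane_def)
qed

section \<open>The braid group\<close>

definition braid_class :: "nat \<Rightarrow> nat gword \<Rightarrow> nat gword set" where
  "braid_class n w = pres_rel {1..<n} (braid_relations n) `` {w}"

lemma braid_gen_class: "braid_gen n i = braid_class n [(i, True)]"
  by (simp add: braid_gen_def pres_gen_def braid_class_def)

lemma braid_class_mult:
  "v \<in> gwords {1..<n} \<Longrightarrow> w \<in> gwords {1..<n} \<Longrightarrow>
    braid_class n v \<otimes>\<^bsub>braid_group n\<^esub> braid_class n w = braid_class n (v @ w)"
  unfolding braid_class_def braid_group_def by (rule pres_mult[OF braid_relations_gwords])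

lemma braid_class_cong:
  "pres_cong {1..<n} (braid_relations n) v w \<Longrightarrow> braid_class n v = braid_class n w"
  unfolding braid_class_def
  using pres_class_eq[OF braid_relations_gwords] pres_cong_gwords[OF braid_relations_gwords] by blast

lemma braid_class_relation:
  assumes "(l, s) \<in> braid_relations n"
  shows "braid_class n l = braid_class n s"
  using pres_cong.rel[of "[]" "{1..<n}" "[]" l s "braid_relations n"] assms
  by (intro braid_class_cong) simp

text \<open>
  The defining relations, read in the group.
\<close>

lemma braid_gen_commute:
  assumes "i \<in> {1..<n}" "j \<in> {1..<n}" "i + 2 \<le> j"
  shows "braid_gen n i \<otimes>\<^bsub>braid_group n\<^esub> braid_gen n j = braid_gen n j \<otimes>\<^bsub>braid_group n\<^esub> braid_gen n i"
proof -
  have "([(i, True), (j, True)], [(j, True), (i, True)]) \<in> braid_relations n"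
    using assms by (auto simp: braid_relations_def)
  from braid_class_relation[OF this] show ?thesis
    using assms by (simp add: braid_gen_class braid_class_mult)
qed

lemma braid_gen_braid:
  assumes "1 \<le> i" "i + 1 < n"
  shows "braid_gen n i \<otimes>\<^bsub>braid_group n\<^esub> (braid_gen n (i + 1) \<otimes>\<^bsub>braid_group n\<^esub> braid_gen n i) =
    braid_gen n (i + 1) \<otimes>\<^bsub>braid_group n\<^esub> (braid_gen n i \<otimes>\<^bsub>braid_group n\<^esub> braid_gen n (i + 1))"
proof -
  have "([(i, True), (i + 1, True), (i, True)], [(i + 1, True), (i, True), (i + 1, True)]) \<in> braid_relations n"
    using assms by (auto simp: braid_relations_def)
  from braid_class_relation[OF this] show ?thesis
    using assms by (simp add: braid_gen_class braid_class_mult)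
qed

text \<open>
  Induction on a word that represents the element, with generators and their inverses as letters.
\<close>

lemma braid_group_induct [consumes 1, case_names one gen inv_gen]:
  assumes g: "g \<in> carrier (braid_group n)"
    and one: "P \<one>\<^bsub>braid_group n\<^esub>"
    and gen: "\<And>i h. i \<in> {1..<n} \<Longrightarrow> h \<in> carrier (braid_group n) \<Longrightarrow> P h \<Longrightarrow>
      P (braid_gen n i \<otimes>\<^bsub>braid_group n\<^esub> h)"
    and inv_gen: "\<And>i h. i \<in> {1..<n} \<Longrightarrow> h \<in> carrier (braid_group n) \<Longrightarrow> P h \<Longrightarrow>
      P (inv\<^bsub>braid_group n\<^esub> braid_gen n i \<otimes>\<^bsub>braid_group n\<^esub> h)"
  shows "P g"
proof -
  interpret G: group "braid_group n" by (rule braid_group)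
  have cc: "braid_class n w \<in> carrier (braid_group n)" if "w \<in> gwords {1..<n}" for w
    unfolding braid_group_def braid_class_def using pres_class_carrier[OF braid_relations_gwords that] .
  have c1: "braid_class n [] = \<one>\<^bsub>braid_group n\<^esub>"
    unfolding braid_group_def braid_class_def using pres_one[OF braid_relations_gwords] by simp
  have "P (braid_class n w)" if "w \<in> gwords {1..<n}" for w
    using that
  proof (induction w)
    case Nil
    then show ?case using one by (simp add: c1)
  next
    case (Cons x w)
    obtain i e where x: "x = (i, e)" by (cases x)
    have i: "i \<in> {1..<n}" and w: "w \<in> gwords {1..<n}" using Cons.prems by (auto simp: x)
    note IH = cc[OF w] Cons.IH[OF w]
    show ?case
    proof (cases e)
      case True
      have "braid_gen n i \<otimes>\<^bsub>braid_group n\<^esub> braid_class n w = braid_class n ((i, True) # w)"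
        using i w by (simp add: braid_gen_class braid_class_mult)
      then show ?thesis using gen[OF i IH] True by (simp add: x)
    next
      case False
      have iw: "(i, False) # w \<in> gwords {1..<n}" using i w by simp
      have "pres_cong {1..<n} (braid_relations n) ([] @ [(i, True), (i, \<not> True)] @ w) ([] @ w)"
        using i w by (intro pres_cong.cancel) auto
      from braid_class_cong[OF this]
      have "braid_class n w = braid_gen n i \<otimes>\<^bsub>braid_group n\<^esub> braid_class n ((i, False) # w)"
        using i iw by (simp add: braid_gen_class braid_class_mult)
      then have "braid_class n ((i, False) # w) = inv\<^bsub>braid_group n\<^esub> braid_gen n i \<otimes>\<^bsub>braid_group n\<^esub> braid_class n w"
        by (intro iffD2[OF G.inv_solve_left] cc iw w braid_gen_carrier i)
      then show ?thesis using inv_gen[OF i IH] False by (simp add: x)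
    qed
  qed
  moreover obtain w where "w \<in> gwords {1..<n}" "g = braid_class n w"
    using pres_carrierE[OF braid_relations_gwords, of g n] g unfolding braid_group_def braid_class_def by blast
  ultimately show ?thesis by blast
qed

section \<open>From a representation to a linear braid action\<close>

lemma GL_carrier_mat: "M \<in> carrier (GL r) \<Longrightarrow> M \<in> carrier_mat r r"
  by (simp add: GL_carrier)

context
  fixes n r :: nat and \<rho> :: "nat gword set \<Rightarrow> complex mat"
  assumes rep: "representation (braid_group n) r \<rho>"
begin

lemma rep_mult: "g \<in> carrier (braid_group n) \<Longrightarrow> h \<in> carrier (braid_group n) \<Longrightarrow>
    \<rho> (g \<otimes>\<^bsub>braid_group n\<^esub> h) = \<rho> g * \<rho> h"
  using rep by (simp add: representation_def hom_mult GL_simps)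

lemma rep_GL: "g \<in> carrier (braid_group n) \<Longrightarrow> \<rho> g \<in> carrier (GL r)"
  using rep by (auto simp: representation_def hom_in_carrier)

lemma rep_mat: "g \<in> carrier (braid_group n) \<Longrightarrow> \<rho> g \<in> carrier_mat r r"
  by (rule GL_carrier_mat[OF rep_GL])

lemma rep_one: "\<rho> \<one>\<^bsub>braid_group n\<^esub> = 1\<^sub>m r"
  using hom_one[of \<rho> "braid_group n" "GL r"] rep braid_group GL_group
  by (simp add: representation_def GL_simps)

lemma rep_inv:
  assumes "g \<in> carrier (braid_group n)"
  shows "\<rho> (inv\<^bsub>braid_group n\<^esub> g) * \<rho> g = 1\<^sub>m r" "\<rho> g * \<rho> (inv\<^bsub>braid_group n\<^esub> g) = 1\<^sub>m r"
proof -
  interpret G: group "braid_group n" by (rule braid_group)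
  show "\<rho> (inv\<^bsub>braid_group n\<^esub> g) * \<rho> g = 1\<^sub>m r" "\<rho> g * \<rho> (inv\<^bsub>braid_group n\<^esub> g) = 1\<^sub>m r"
    using assms by (simp_all add: rep_mult[symmetric] rep_one)
qed

lemma invariant_under_group:
  assumes W: "\<And>i. i \<in> {1..<n} \<Longrightarrow> act r (\<rho> (braid_gen n i)) ` W = W"
    and g: "g \<in> carrier (braid_group n)" and f: "f \<in> W"
  shows "act r (\<rho> g) f \<in> W"
  using g f
proof (induction g arbitrary: f rule: braid_group_induct)
  case one
  then show ?case by (simp add: rep_one act_one)
next
  case (gen i h)
  then have "act r (\<rho> (braid_gen n i)) (act r (\<rho> h) f) \<in> W" using W[OF gen(1)] by blast
  then show ?case
    using gen(1,2) by (simp add: rep_mult braid_gen_carrier act_mult rep_mat)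
next
  case (inv_gen i h)
  interpret G: group "braid_group n" by (rule braid_group)
  have gi: "braid_gen n i \<in> carrier (braid_group n)" using braid_gen_carrier[OF inv_gen(1)] .
  have gi': "inv\<^bsub>braid_group n\<^esub> braid_gen n i \<in> carrier (braid_group n)" using gi by simp
  have "act r (\<rho> h) f \<in> W" using inv_gen by blast
  then obtain f' where f': "f' \<in> W" "act r (\<rho> h) f = act r (\<rho> (braid_gen n i)) f'"
    using W[OF inv_gen(1)] by blast
  have "act r (\<rho> (inv\<^bsub>braid_group n\<^esub> braid_gen n i)) (act r (\<rho> (braid_gen n i)) f') = f'"
    by (simp only: act_mult[OF rep_mat[OF gi'] rep_mat[OF gi], symmetric] rep_inv(1)[OF gi] act_one)
  then show ?case
    using f' by (simp add: rep_mult[OF gi' inv_gen(2)] act_mult[OF rep_mat[OF gi'] rep_mat[OF inv_gen(2)]])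
qed

text \<open>
  Reading functions supported on the first \<open>r\<close> coordinates as vectors identifies \<open>W\<close> with a subspace
  that is invariant under the whole group.
\<close>

lemma irreducible_action:
  assumes irr: "irreducible_rep (braid_group n) r \<rho>"
    and sub: "coords.subspace W" "W \<subseteq> coords.span (unit_fun ` {..<r})"
    and inv: "\<And>i. i \<in> {1..<n} \<Longrightarrow> act r (\<rho> (braid_gen n i)) ` W = W"
  shows "W = {0} \<or> W = coords.span (unit_fun ` {..<r})"
proof -
  have supp: "f i = 0" if "f \<in> W" "r \<le> i" for f i using that sub(2) by (auto simp: span_unit_funs)
  have inj: "f = h" if "f \<in> W" "\<And>i. r \<le> i \<Longrightarrow> h i = 0" "vec r f = vec r h" for f h
  proof
    fix i
    show "f i = h i"
    proof (cases "i < r")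
      case True
      then show ?thesis using arg_cong[OF that(3), of "\<lambda>v. v $ i"] by simp
    qed (use supp that in simp)
  qed
  have vec_add: "vec r f + vec r h = vec r (f + h)" and vec_smul: "c \<cdot>\<^sub>v vec r f = vec r (smul c f)"
    for f h :: "nat \<Rightarrow> complex" and c by (auto simp: smul_def)
  have "submodule class_ring (vec r ` W) (module_vec TYPE(complex) r)"
  proof (rule submodule.intro)
    show "module class_ring (module_vec TYPE(complex) r)" by (rule vec_module)
    show "vec r ` W \<subseteq> carrier (module_vec TYPE(complex) r)" by (auto simp: module_vec_simps)
    have "vec r 0 = (0\<^sub>v r :: complex vec)" by auto
    then show "\<zero>\<^bsub>module_vec TYPE(complex) r\<^esub> \<in> vec r ` W"
      using coords.subspace_0[OF sub(1)] by (metis image_eqI module_vec_simps(2))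
    fix v w assume "v \<in> vec r ` W" "w \<in> vec r ` W"
    then obtain f h where "f \<in> W" "h \<in> W" "v = vec r f" "w = vec r h" by blast
    then show "v \<oplus>\<^bsub>module_vec TYPE(complex) r\<^esub> w \<in> vec r ` W"
      using coords.subspace_add[OF sub(1)] by (auto simp: module_vec_simps vec_add)
  next
    fix c v assume "v \<in> vec r ` W"
    then obtain f where "f \<in> W" "v = vec r f" by blast
    then show "c \<odot>\<^bsub>module_vec TYPE(complex) r\<^esub> v \<in> vec r ` W"
      using coords.subspace_scale[OF sub(1)] by (auto simp: module_vec_simps vec_smul)
  qed
  then have "VectorSpace.subspace class_ring (vec r ` W) (module_vec TYPE(complex) r)"
    using vec_vs by (auto simp: VectorSpace.subspace_def)
  moreover have "\<rho> g *\<^sub>v v \<in> vec r ` W" if g: "g \<in> carrier (braid_group n)" and v: "v \<in> vec r ` W" for g v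
  proof -
    obtain f where f: "f \<in> W" "v = vec r f" using v by blast
    then have "act r (\<rho> g) f \<in> W" using invariant_under_group[OF inv g] by blast
    then show ?thesis using vec_act[OF rep_mat[OF g], of f] f(2) by (metis image_eqI)
  qed
  ultimately have "vec r ` W = {0\<^sub>v r} \<or> vec r ` W = carrier_vec r"
    using irr unfolding irreducible_rep_def by blast
  then show ?thesis
  proof
    assume 0: "vec r ` W = {0\<^sub>v r}"
    have "f = 0" if "f \<in> W" for f
    proof (rule inj[OF that])
      have "vec r f = 0\<^sub>v r" using 0 that by blast
      then show "vec r f = vec r 0" by auto
    qed simp
    then show ?thesis using coords.subspace_0[OF sub(1)] by blast
  next
    assume full: "vec r ` W = carrier_vec r"
    have "h \<in> W" if h: "h \<in> coords.span (unit_fun ` {..<r})" for h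
    proof -
      have "vec r h \<in> vec r ` W" unfolding full by simp
      then obtain f where f: "f \<in> W" "vec r f = vec r h" by auto
      then have "f = h" using h by (intro inj) (auto simp: span_unit_funs)
      then show ?thesis using f by simp
    qed
    then show ?thesis using sub(2) by blast
  qed
qed

lemma rank_two_braid_action:
  assumes n: "6 \<le> n" "n \<le> r" and irr: "irreducible_rep (braid_group n) r \<rho>"
    and B: "B \<in> carrier_mat r r" "\<rho> (braid_gen n 1) = 1\<^sub>m r + B" "vec_space.rank r B = 2"
  shows "rank_two_braid smul n (unit_fun ` {..<r}) (\<lambda>i. act r (\<rho> (braid_gen n i)))"
proof -
  note gc = braid_gen_carrier
  interpret G: group "braid_group n" by (rule braid_group)
  show ?thesis
  proof (intro rank_two_braid.intro rank_two_braid_axioms.intro)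
    show "complex_space smul" by unfold_locales
    show "6 \<le> n" by (rule n)
    show "\<not> coords.dependent (unit_fun ` {..<r})" by (rule independent_unit_funs)
    show "finite (unit_fun ` {..<r})" by simp
    show "n \<le> card (unit_fun ` {..<r})" using n card_image[OF inj_on_subset[OF inj_unit_fun]] by simp
  next
    fix i assume i: "i \<in> {1..<n}"
    show "Vector_Spaces.linear smul smul (act r (\<rho> (braid_gen n i)))"
      by (rule linear_act[OF rep_mat[OF gc[OF i]]])
    show "bij (act r (\<rho> (braid_gen n i)))" by (rule bij_act[OF rep_GL[OF gc[OF i]]])
    show "act r (\<rho> (braid_gen n i)) x - x \<in> coords.span (unit_fun ` {..<r})" for x
      by (simp add: span_unit_funs act_def)
  next
    fix i j x assume i: "i \<in> {1..<n}" and j: "j \<in> {1..<n}" and ij: "i + 2 \<le> j"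
    from arg_cong[OF braid_gen_commute[OF i j ij], of \<rho>]
    show "act r (\<rho> (braid_gen n i)) (act r (\<rho> (braid_gen n j)) x) =
        act r (\<rho> (braid_gen n j)) (act r (\<rho> (braid_gen n i)) x)"
      by (simp only: rep_mult gc[OF i] gc[OF j] act_mult[OF rep_mat rep_mat, symmetric])
  next
    fix i x assume i1: "1 \<le> i" "i + 1 < n"
    then have i: "i \<in> {1..<n}" and j: "i + 1 \<in> {1..<n}" by auto
    have act3: "act r L (act r M (act r N x)) = act r (L * (M * N)) x"
      if "L \<in> carrier_mat r r" "M \<in> carrier_mat r r" "N \<in> carrier_mat r r" for L M N
      using that by (simp add: act_mult mult_carrier_mat[of _ r r _ r])
    from arg_cong[OF braid_gen_braid[OF i1], of \<rho>]
    show "act r (\<rho> (braid_gen n i)) (act r (\<rho> (braid_gen n (i + 1))) (act r (\<rho> (braid_gen n i)) x)) =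
        act r (\<rho> (braid_gen n (i + 1))) (act r (\<rho> (braid_gen n i)) (act r (\<rho> (braid_gen n (i + 1))) x))"
      by (simp only: rep_mult gc[OF i] gc[OF j] G.m_closed act3 rep_mat[OF gc[OF i]] rep_mat[OF gc[OF j]])
  next
    fix x :: "nat \<Rightarrow> complex"
    let ?y = "\<lambda>i. if i < r then x i else 0"
    have "act r (\<rho> (braid_gen n i)) (x - ?y) = x - ?y" if i: "i \<in> {1..<n}" for i
    proof
      fix k
      have "vec r (x - ?y) = 0\<^sub>v r" by auto
      then show "act r (\<rho> (braid_gen n i)) (x - ?y) k = (x - ?y) k"
        using rep_mat[OF gc[OF i]] by (simp add: act_def)
    qed
    moreover have "?y \<in> coords.span (unit_fun ` {..<r})" by (simp add: span_unit_funs)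
    ultimately show "\<exists>y\<in>coords.span (unit_fun ` {..<r}). \<forall>i\<in>{1..<n}. act r (\<rho> (braid_gen n i)) (x - y) = x - y"
      by blast
  next
    show "coords.plane (range (\<lambda>x. act r (\<rho> (braid_gen n 1)) x - x))"
      unfolding B(2) by (rule plane_of_rank_two[OF B(1,3)])
  next
    fix W assume "coords.subspace W" "W \<subseteq> coords.span (unit_fun ` {..<r})"
      "\<And>i. i \<in> {1..<n} \<Longrightarrow> act r (\<rho> (braid_gen n i)) ` W = W"
    then show "W = {0} \<or> W = coords.span (unit_fun ` {..<r})" by (rule irreducible_action[OF irr])
  qed
qed

end

text \<open>
  If \<open>P\<close> intertwines \<open>\<rho>(\<sigma>)\<close> and \<open>\<tau>(\<sigma>)\<close>, it also intertwines their inverses.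
\<close>

lemma intertwiner_extends:
  assumes rho: "representation (braid_group n) m \<rho>" and tau: "representation (braid_group n) m \<tau>"
    and P: "P \<in> carrier_mat m m"
    and gens: "\<And>i. i \<in> {1..<n} \<Longrightarrow> \<rho> (braid_gen n i) * P = P * \<tau> (braid_gen n i)"
    and g: "g \<in> carrier (braid_group n)"
  shows "\<rho> g * P = P * \<tau> g"
  using g
proof (induction g rule: braid_group_induct)
  case one
  then show ?case using P by (simp add: rep_one[OF rho] rep_one[OF tau])
next
  case (gen i h)
  note gi = braid_gen_carrier[OF gen(1)]
  note mats = rep_mat[OF rho gi] rep_mat[OF tau gi] rep_mat[OF rho gen(2)] rep_mat[OF tau gen(2)]
  note assoc = assoc_mult_mat[of _ m m _ m _ m]
  have "\<rho> (braid_gen n i) * \<rho> h * P = \<rho> (braid_gen n i) * (\<rho> h * P)"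
    by (rule assoc) (use mats P in auto)
  also have "\<dots> = \<rho> (braid_gen n i) * P * \<tau> h"
    unfolding gen(3) by (rule assoc[symmetric]) (use mats P in auto)
  also have "\<dots> = P * (\<tau> (braid_gen n i) * \<tau> h)"
    unfolding gens[OF gen(1)] by (rule assoc) (use mats P in auto)
  finally show ?case using gi gen(2) by (simp add: rep_mult[OF rho] rep_mult[OF tau])
next
  case (inv_gen i h)
  interpret G: group "braid_group n" by (rule braid_group)
  note gi = braid_gen_carrier[OF inv_gen(1)]
  note gi' = G.inv_closed[OF gi]
  let ?R = "\<rho> (braid_gen n i)" and ?T = "\<tau> (braid_gen n i)"
  let ?R' = "\<rho> (inv\<^bsub>braid_group n\<^esub> braid_gen n i)" and ?T' = "\<tau> (inv\<^bsub>braid_group n\<^esub> braid_gen n i)"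
  note mats = rep_mat[OF rho gi] rep_mat[OF tau gi] rep_mat[OF rho gi'] rep_mat[OF tau gi']
    rep_mat[OF rho inv_gen(2)] rep_mat[OF tau inv_gen(2)] P
  note assoc = assoc_mult_mat[of _ m m _ m _ m]
  have "?R' * P = ?R' * (P * (?T * ?T'))" using mats by (simp add: rep_inv[OF tau gi])
  also have "P * (?T * ?T') = ?R * P * ?T'"
    unfolding gens[OF inv_gen(1)] by (rule assoc[symmetric]) (use mats in auto)
  also have "?R' * \<dots> = ?R' * (?R * P) * ?T'"
    by (rule assoc[symmetric]) (use mats in auto)
  also have "?R' * (?R * P) = ?R' * ?R * P"
    by (rule assoc[symmetric]) (use mats in auto)
  also have "\<dots> = P" using mats by (simp add: rep_inv[OF rho gi])
  finally have inv: "?R' * P = P * ?T'" .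
  have "?R' * \<rho> h * P = ?R' * (\<rho> h * P)" by (rule assoc) (use mats in auto)
  also have "\<dots> = ?R' * P * \<tau> h"
    unfolding inv_gen(3) by (rule assoc[symmetric]) (use mats in auto)
  also have "\<dots> = P * (?T' * \<tau> h)"
    unfolding inv by (rule assoc) (use mats in auto)
  finally show ?case using gi' inv_gen(2) by (simp add: rep_mult[OF rho] rep_mult[OF tau])
qed

lemma span_family_combination:
  fixes n :: nat
  assumes "f \<in> coords.span (w ` {..<n})"
  shows "\<exists>q. f = (\<Sum>j<n. smul (q j) (w j))"
  using assms
proof (induction rule: coords.span_induct_alt)
  case base
  show ?case by (rule exI[of _ "\<lambda>_. 0"]) (simp add: smul_def zero_fun_def[symmetric])
next
  case (step c x y)
  then obtain q k where q: "y = (\<Sum>j<n. smul (q j) (w j))" and k: "k < n" "x = w k" by blast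
  have "(\<Sum>j<n. smul (q j + (if j = k then c else 0)) (w j)) =
      (\<Sum>j<n. smul (q j) (w j)) + (\<Sum>j<n. if j = k then smul c (w j) else 0)"
    by (subst sum.distrib[symmetric], rule sum.cong) (auto simp: smul_def fun_eq_iff algebra_simps)
  also have "(\<Sum>j<n. if j = k then smul c (w j) else 0) = smul c x"
    using k by (subst sum.delta) auto
  also have "(\<Sum>j<n. smul (q j) (w j)) + smul c x = smul c x + y" by (simp add: q add.commute)
  finally show ?case by metis
qed

text \<open>
  The matrix \<open>P\<close> with columns \<open>w\<^sub>0, \<dots>, w\<^sub>n\<^sub>-\<^sub>1\<close> intertwines the two representations. Its inverse \<open>Q\<close>
  consists of the coefficients that express the standard basis in terms of the \<open>w\<^sub>j\<close>.
\<close>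

lemma equivalent_std_rep:
  assumes rep: "representation (braid_group n) n \<rho>" and u: "u \<noteq> 0"
    and w: "coords.span (unit_fun ` {..<n}) \<subseteq> coords.span (w ` {..<n})"
      "\<And>i. i \<in> {1..<n} \<Longrightarrow> act n (\<rho> (braid_gen n i)) (w (i - 1)) = w i"
      "\<And>i. i \<in> {1..<n} \<Longrightarrow> act n (\<rho> (braid_gen n i)) (w i) = smul u (w (i - 1))"
      "\<And>i j. i \<in> {1..<n} \<Longrightarrow> j < n \<Longrightarrow> j \<noteq> i - 1 \<Longrightarrow> j \<noteq> i \<Longrightarrow> act n (\<rho> (braid_gen n i)) (w j) = w j"
  shows "equivalent_reps (braid_group n) n \<rho> (std_rep n u)"
proof -
  define P where "P = mat n n (\<lambda>(j, k). w k j)"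
  have P: "P \<in> carrier_mat n n" by (simp add: P_def)
  have "\<exists>q. unit_fun k = (\<Sum>j<n. smul (q j) (w j))" if "k < n" for k
    using span_family_combination w(1) coords.span_base[of "unit_fun k" "unit_fun ` {..<n}"] that by blast
  then obtain q where q: "\<And>k. k < n \<Longrightarrow> unit_fun k = (\<Sum>j<n. smul (q k j) (w j))" by metis
  define Q where "Q = mat n n (\<lambda>(j, k). q k j)"
  have Q: "Q \<in> carrier_mat n n" by (simp add: Q_def)
  have PQ: "P * Q = 1\<^sub>m n"
  proof (rule eq_matI)
    fix i k assume "i < dim_row (1\<^sub>m n :: complex mat)" "k < dim_col (1\<^sub>m n :: complex mat)"
    then have ik: "i < n" "k < n" by auto
    have "(P * Q) $$ (i, k) = (\<Sum>j = 0..<n. w j i * q k j)"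
      using ik by (simp add: P_def Q_def scalar_prod_def)
    also have "\<dots> = (\<Sum>j<n. smul (q k j) (w j)) i"
      by (simp add: sum_fun_apply smul_def atLeast0LessThan mult.commute)
    also have "\<dots> = unit_fun k i" using q[OF ik(2)] by simp
    finally show "(P * Q) $$ (i, k) = 1\<^sub>m n $$ (i, k)" using ik by (simp add: unit_fun_def)
  qed (use P Q in auto)
  have QP: "Q * P = 1\<^sub>m n" by (rule mat_mult_left_right_inverse[OF P Q PQ])
  have gens: "\<rho> (braid_gen n i) * P = P * std_rep n u (braid_gen n i)" if i: "i \<in> {1..<n}" for i
  proof -
    let ?R = "\<rho> (braid_gen n i)"
    have R: "?R \<in> carrier_mat n n" using rep_mat[OF rep] braid_gen_carrier[OF i] .
    show ?thesis
      unfolding std_rep_gen[OF u i] std_mat_monomial[OF i]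
    proof (rule eq_matI)
      let ?p = "Transposition.transpose (i - 1) i" and ?c = "\<lambda>k. if k = i then u else 1"
      fix j k assume "j < dim_row (P * monomial_mat n ?p ?c)" "k < dim_col (P * monomial_mat n ?p ?c)"
      then have jk: "j < n" "k < n" by (simp_all add: P_def monomial_mat_def)
      have pk: "?p k < n" using jk i by (auto simp: Transposition.transpose_def)
      have "(?R * P) $$ (j, k) = act n ?R (w k) j"
        using jk R by (simp add: act_def P_def scalar_prod_def)
      also have "\<dots> = ?c k * w (?p k) j"
        using w(2)[OF i] w(3)[OF i] w(4)[OF i jk(2)] i
        by (cases "k = i"; cases "k = i - 1") (auto simp: smul_def Transposition.transpose_def)
      also have "\<dots> = (\<Sum>l = 0..<n. w l j * (if l = ?p k then ?c k else 0))"
        using pk by (simp add: if_distrib[of "\<lambda>x. _ * x"] cong: if_cong)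
      also have "\<dots> = (P * monomial_mat n ?p ?c) $$ (j, k)"
        using jk by (simp add: P_def monomial_mat_def scalar_prod_def)
      finally show "(?R * P) $$ (j, k) = (P * monomial_mat n ?p ?c) $$ (j, k)" .
    qed (use R P in \<open>auto simp: monomial_mat_def\<close>)
  qed
  have QGL: "Q \<in> carrier (GL n)" and PGL: "P \<in> carrier (GL n)" using P Q PQ QP by (auto simp: GL_carrier)
  interpret GL: group "GL n" by (rule GL_group)
  have invQ: "inv\<^bsub>GL n\<^esub> Q = P" using GL.inv_equality[OF _ QGL PGL] PQ by (simp add: GL_simps)
  show ?thesis
    unfolding equivalent_reps_def
  proof (intro bexI[of _ Q] ballI)
    fix g assume g: "g \<in> carrier (braid_group n)"
    note std = std_rep_representation[OF u]
    have mats: "\<rho> g \<in> carrier_mat n n" "std_rep n u g \<in> carrier_mat n n"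
      using rep_mat[OF rep g] rep_mat[OF std g] .
    have "Q * \<rho> g * inv\<^bsub>GL n\<^esub> Q = Q * (\<rho> g * P)"
      unfolding invQ using mats P Q by (simp add: assoc_mult_mat[of _ n n _ n _ n])
    also have "\<rho> g * P = P * std_rep n u g"
      by (rule intertwiner_extends[OF rep std P gens g])
    also have "Q * \<dots> = (Q * P) * std_rep n u g"
      using mats P Q by (simp add: assoc_mult_mat[of _ n n _ n _ n])
    also have "\<dots> = std_rep n u g" using mats by (simp add: QP)
    finally show "std_rep n u g = Q * \<rho> g * inv\<^bsub>GL n\<^esub> Q" by simp
  qed (rule QGL)
qed

section \<open>Non-equivalence of the standard representations\<close>

lemma std_mat_square:
  assumes "2 \<le> n"
  shows "std_mat n u 1 * std_mat n u 1 = monomial_mat n id (\<lambda>k. if k < 2 then u else 1)"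
proof -
  have 1: "1 \<in> {1..<n}" using assms by auto
  show ?thesis
    unfolding std_mat_monomial[OF 1] monomial_mat_mult[OF transposition_funcset[OF 1]]
    by (rule monomial_mat_cong) (auto simp: Transposition.transpose_def)
qed

text \<open>
  A conjugating matrix \<open>P\<close> maps the first basis vector, which is an eigenvector of the square of
  \<open>\<tau>\<^sub>u(\<sigma>\<^sub>1)\<close> with eigenvalue \<open>u\<close>, to an eigenvector of the square of \<open>\<tau>\<^sub>v(\<sigma>\<^sub>1)\<close> with the same eigenvalue. But
  that matrix is diagonal with entries \<open>v\<close> and 1. So the first column of \<open>P\<close> would vanish.
\<close>

lemma std_reps_not_equivalent:
  assumes n: "2 \<le> n" and u: "u \<noteq> 0" "u \<noteq> 1" and v: "v \<noteq> 0" "u \<noteq> v"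
  shows "\<not> equivalent_reps (braid_group n) n (std_rep n u) (std_rep n v)"
proof
  assume "equivalent_reps (braid_group n) n (std_rep n u) (std_rep n v)"
  then obtain P where PGL: "P \<in> carrier (GL n)" and
    conj: "\<And>g. g \<in> carrier (braid_group n) \<Longrightarrow> std_rep n v g = P * std_rep n u g * inv\<^bsub>GL n\<^esub> P"
    by (auto simp: equivalent_reps_def)
  interpret GL: group "GL n" by (rule GL_group)
  have 1: "1 \<in> {1..<n}" using n by auto
  note g1 = braid_gen_carrier[OF 1]
  let ?U = "std_mat n u 1" and ?V = "std_mat n v 1" and ?P' = "inv\<^bsub>GL n\<^esub> P"
  have U: "?U \<in> carrier (GL n)" and V: "?V \<in> carrier (GL n)" using std_mat_carrier u v 1 by blast+
  have P'GL: "?P' \<in> carrier (GL n)" using PGL by simp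
  note mats = GL_carrier_mat[OF PGL] GL_carrier_mat[OF P'GL] GL_carrier_mat[OF U] GL_carrier_mat[OF V]
  have P'P: "?P' * P = 1\<^sub>m n" using GL.l_inv[OF PGL] by (simp add: GL_simps)
  have "?V = P * ?U * ?P'" using conj[OF g1] std_rep_gen[OF u(1) 1] std_rep_gen[OF v(1) 1] by simp
  then have "?V * P = P * ?U * (?P' * P)"
    using mats by (simp add: assoc_mult_mat[of _ n n _ n _ n] mult_carrier_mat[of _ n n _ n])
  then have VP: "?V * P = P * ?U"
    using mats by (simp add: P'P mult_carrier_mat[of _ n n _ n])
  note assoc = assoc_mult_mat[of _ n n _ n _ n]
  have "?V * ?V * P = ?V * (P * ?U)"
    unfolding VP[symmetric] by (rule assoc) (use mats in auto)
  also have "\<dots> = ?V * P * ?U" by (rule assoc[symmetric]) (use mats in auto)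
  also have "?V * P * ?U = P * ?U * ?U" by (simp only: VP)
  also have "\<dots> = P * (?U * ?U)" by (rule assoc) (use mats in auto)
  finally have "?V * ?V * P = P * (?U * ?U)" .
  then have eq: "monomial_mat n id (\<lambda>k. if k < 2 then v else 1) * P = P * monomial_mat n id (\<lambda>k. if k < 2 then u else 1)"
    by (simp only: std_mat_square[OF n])
  have "P $$ (j, 0) = 0" if j: "j < n" for j
  proof -
    have 0: "0 < n" using n by simp
    have "(monomial_mat n id (\<lambda>k. if k < 2 then v else 1) * P) $$ (j, 0) =
        (\<Sum>l = 0..<n. (if j = l then if l < 2 then v else 1 else 0) * P $$ (l, 0))"
      using j 0 mats(1) by (simp add: monomial_mat_def scalar_prod_def)
    also have "\<dots> = (\<Sum>l = 0..<n. if l = j then (if j < 2 then v else 1) * P $$ (j, 0) else 0)"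
      by (rule sum.cong) auto
    also have "\<dots> = (if j < 2 then v else 1) * P $$ (j, 0)" using j by simp
    finally have left: "(monomial_mat n id (\<lambda>k. if k < 2 then v else 1) * P) $$ (j, 0) =
        (if j < 2 then v else 1) * P $$ (j, 0)" .
    have "(P * monomial_mat n id (\<lambda>k. if k < 2 then u else 1)) $$ (j, 0) =
        (\<Sum>l = 0..<n. P $$ (j, l) * (if l = 0 then u else 0))"
      using j 0 mats(1) by (simp add: monomial_mat_def scalar_prod_def)
    also have "\<dots> = (\<Sum>l = 0..<n. if l = 0 then P $$ (j, 0) * u else 0)"
      by (rule sum.cong) auto
    also have "\<dots> = P $$ (j, 0) * u" using 0 by simp
    finally have right: "(P * monomial_mat n id (\<lambda>k. if k < 2 then u else 1)) $$ (j, 0) = P $$ (j, 0) * u" .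
    have "(if j < 2 then v else 1) * P $$ (j, 0) = P $$ (j, 0) * u"
      by (simp only: left[symmetric] eq right)
    then show ?thesis using u v by (auto split: if_splits)
  qed
  then have "(?P' * P) $$ (0, 0) = 0"
    using mats n by (simp add: scalar_prod_def)
  then show False using P'P n by simp
qed

theorem theorem5p5:
  fixes n :: nat
  assumes "n \<ge> 6"
  shows "(\<forall>(r::nat) (\<rho> :: nat gword set \<Rightarrow> complex mat) (A\<^sub>1 :: complex mat).
            r \<ge> n \<and> irreducible_rep (braid_group n) r \<rho> \<and>
            A\<^sub>1 \<in> carrier_mat r r \<and> \<rho> (braid_gen n 1) = 1\<^sub>m r + A\<^sub>1 \<and> vec_space.rank r A\<^sub>1 = 2 \<longrightarrow>
            r = n \<and>
            (\<exists>u::complex. u \<noteq> 0 \<and> u \<noteq> 1 \<and> equivalent_reps (braid_group n) n \<rho> (std_rep n u)))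
       \<and> (\<forall>u v :: complex. u \<noteq> 0 \<and> u \<noteq> 1 \<and> v \<noteq> 0 \<and> v \<noteq> 1 \<and> u \<noteq> v \<longrightarrow>
            \<not> equivalent_reps (braid_group n) n (std_rep n u) (std_rep n v))"
proof (intro conjI allI impI; (elim conjE)?)
  fix r \<rho> and A\<^sub>1 :: "complex mat"
  assume r: "n \<le> r" and irr: "irreducible_rep (braid_group n) r \<rho>"
    and A1: "A\<^sub>1 \<in> carrier_mat r r" "\<rho> (braid_gen n 1) = 1\<^sub>m r + A\<^sub>1" "vec_space.rank r A\<^sub>1 = 2"
  have rep: "representation (braid_group n) r \<rho>" using irr by (simp add: irreducible_rep_def)
  interpret rank_two_braid smul n "unit_fun ` {..<r}" "\<lambda>i. act r (\<rho> (braid_gen n i))"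
    by (rule rank_two_braid_action[OF rep assms r irr A1])
  obtain u w where u: "u \<noteq> 0" "u \<noteq> 1"
    and span: "coords.span (unit_fun ` {..<r}) \<subseteq> coords.span (w ` {..<n})"
    and w: "\<And>i. i \<in> {1..<n} \<Longrightarrow> act r (\<rho> (braid_gen n i)) (w (i - 1)) = w i"
      "\<And>i. i \<in> {1..<n} \<Longrightarrow> act r (\<rho> (braid_gen n i)) (w i) = smul u (w (i - 1))"
      "\<And>i j. i \<in> {1..<n} \<Longrightarrow> j < n \<Longrightarrow> j \<noteq> i - 1 \<Longrightarrow> j \<noteq> i \<Longrightarrow> act r (\<rho> (braid_gen n i)) (w j) = w j"
    by (rule normal_form[unfolded I_def]) (rule that, assumption+)
  have "card (unit_fun ` {..<r}) \<le> card (w ` {..<n})"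
    using coords.independent_span_bound[OF _ independent_unit_funs, of "w ` {..<n}" "{..<r}"] span
      coords.span_superset[of "unit_fun ` {..<r}"] by blast
  also have "\<dots> \<le> n" using card_image_le[of "{..<n}" w] by simp
  also have "card (unit_fun ` {..<r}) = r" using card_image[OF inj_on_subset[OF inj_unit_fun]] by simp
  finally show rn: "r = n" using r by simp
  show "\<exists>u. u \<noteq> 0 \<and> u \<noteq> 1 \<and> equivalent_reps (braid_group n) n \<rho> (std_rep n u)"
    using u equivalent_std_rep[OF rep[unfolded rn] u(1) span[unfolded rn] w[unfolded rn]] by blast
next
  fix u v :: complex assume "u \<noteq> 0" "u \<noteq> 1" "v \<noteq> 0" "v \<noteq> 1" "u \<noteq> v"
  then show "\<not> equivalent_reps (braid_group n) n (std_rep n u) (std_rep n v)"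
    using std_reps_not_equivalent assms by simp
qed

end
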